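(* Let $N=\{1,\dots,n\}$ be a finite set of agents, $A$ a non-empty finite set of objects, $a_0$ the outside option, and $\succ_A=(\succ_a)_{a\in A}$ a priority structure. Suppose $\mathcal{P}_N\in\{\mathbb{L}^n(A),\ \mathbb{L}^n(A\cup\{a_0\})\}$. On the domain $\mathcal{P}_N$, the FPTTC rule $T^{\succ_A}$ is simply strategy-proof if and only if it is SOSP-implementable.
   Context: **Setting.** $N=\{1,\dots,n\}$ is a finite set of agents, $A$ a non-empty finite set of objects, and $a_0\notin A$ the outside option. An allocation is a function $\mu:N\to A\cup\{a_0\}$ with $|\mu^{-1}(a)|\le 1$ for all $a\in A$; $\mathcal{M}$ is the set of allocations. For a finite set $X$, $\mathbb{L}(X)$ is the set of strict linear orders on $X$; a preference is an element $P$ of $\mathbb{L}(A\cup\{a_0\})$, with weak part $R$ ($x\,R\,y$ iff $x\,P\,y$ or $x=y$). By abuse of notation, $\mathbb{L}(A)=\{P\in\mathbb{L}(A\cup\{a_0\}) : a\,P\,a_0 \text{ for all } a\in A\}$; $\mathbb{L}^n(\cdot)$ denotes the $n$-fold product. A domain is a product $\mathcal{P}_N=\prod_{i\in N}\mathcal{P}_i$ with $\mathcal{P}_i\subseteq\mathbb{L}(A\cup\{a_0\})$; an assignment rule is a function $f:\mathcal{P}_N\to\mathcal{M}$, and $f_i(P_N)$ is agent $i$'s assignment. Object $a$ is acceptable to $i$ if $a\,P_i\,a_0$. A priority structure is a collection $\succ_A=(\succ_a)_{a\in A}$ with $\succ_a\in\mathbb{L}(N)$; $\tau(\succ,N')$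 is the $\succ$-maximal agent in $N'\subseteq N$. **FPTTC rule.** The fixed priority top trading cycles (FPTTC) rule $T^{\succ_A}$ associated with $\succ_A$ is computed at a profile $P_N$ in steps. At Step $s$, let $N_s(P_N)$ and $A_s(P_N)$ be the sets of agents and objects remaining after Step $s-1$ (so $N_1(P_N)=N$, $A_1(P_N)=A$). Each $a\in A_s(P_N)$ is owned by $\tau(\succ_a,N_s(P_N))$. Form the directed graph on $N_s(P_N)$ in which each agent $i$ points to the owner of her most preferred acceptable object in $A_s(P_N)$, or to herself if no object in $A_s(P_N)$ is acceptable to her. Each agent in a cycle of this graph (self-loops included) is assigned her most preferred element of $A_s(P_N)\cup\{a_0\}$; assigned agents and assigned objects are removed. The procedure is repeated until all agents or all objects are assigned; any agent unassigned at the end receives $a_0$. **Mechanisms.** For a rooted directed tree $T$, let $V(T),E(T),r(T),L(T)$ denote its nodes, edges, root and leaves; $E^{out}(v)$ the outgoing edges of $v$; $s(e)$ the source of $e$. A path is a sequence of nodes in which consecutive nodes form an edge. A mechanism on $\mathcal{P}_N$ is a tuple $G=\langle T,\eta^{LA},\eta^{NA},\eta^{EP}\rangle$ where $T$ is a rooted tree, $\eta^{LA}:L(T)\to\mathcal{M}$, $\eta^{NA}:V(T)\setminus L(T)\to N$, and $\eta^{EP}:E(T)\to 2^{\mathbb{L}(A\cup\{a_0\})}\setminus\{\emptyset\}$ such that (a) $\eta^{EP}(e)\cap\eta^{EP}(e')=\emptyset$ for distinct $e,e'$ with $s(e)=s(e')$; (b) for each $v\in V(T)\setminus L(T)$: if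 on the path $(v^1,\dots,v^t)$ from $r(T)$ to $v$ there is $t'<t$ with $\eta^{NA}(v^{t'})=\eta^{NA}(v)$ and $\eta^{NA}(v^{s})\ne\eta^{NA}(v)$ for $t'<s<t$, then $\bigcup_{e\in E^{out}(v)}\eta^{EP}(e)=\eta^{EP}(v^{t'},v^{t'+1})$; otherwise $\bigcup_{e\in E^{out}(v)}\eta^{EP}(e)=\mathcal{P}_{\eta^{NA}(v)}$. Each $P_N\in\mathcal{P}_N$ determines a unique root-to-leaf path, following at each node $v$ the outgoing edge $e$ with $P_{\eta^{NA}(v)}\in\eta^{EP}(e)$; $P_N$ passes through the nodes of this path, and $f^G(P_N)=\eta^{LA}(l)$ where $l$ is its leaf. Preferences $P_i,P_i'$ diverge at $v$ if $\eta^{NA}(v)=i$ and they belong to $\eta^{EP}(e),\eta^{EP}(e')$ for two distinct $e,e'\in E^{out}(v)$. **OSP.** $G$ is OSP if for all $i\in N$, all $v$ with $\eta^{NA}(v)=i$, and all $P_N,\tilde P_N\in\mathcal{P}_N$ passing through $v$ such that $P_i,\tilde P_i$ diverge at $v$, we have $f^G_i(P_N)\,R_i\,f^G_i(\tilde P_N)$. **SOSP.** $G$ is SOSP if for all $i\in N$, all $v$ with $\eta^{NA}(v)=i$, and all $P_N,P'_N,\tilde P_N\in\mathcal{P}_N$ passing through $v$ such that $P_i,P'_i$ do not diverge at $v$ and $P_i,\tilde P_i$ diverge at $v$, we have $f^G_i(P'_N)\,R_i\,f^G_i(\tilde P_N)$. An assignment rule $f$ on $\mathcal{P}_N$ is SOSP-implementable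 if $f=f^G$ for some SOSP mechanism $G$ on $\mathcal{P}_N$. **Simple strategy-proofness.** $G$ is simple if $\eta^{NA}(v)\neq\eta^{NA}(v')$ for all distinct $v,v'\in V(T)\setminus L(T)$ that appear in the same path. An assignment rule $f$ on $\mathcal{P}_N$ is simply strategy-proof if $f=f^G$ for some mechanism $G$ on $\mathcal{P}_N$ that is both simple and OSP. *)

theory Defs
  imports Main "HOL-Library.FuncSet" "HOL-Library.While_Combinator"
begin

section \<open>Preferences, domains and allocations\<close>

text \<open>
  A strict order is the set of pairs \<open>(x, y)\<close> with \<open>x\<close> strictly above \<open>y\<close>; its weak part is
  \<open>P\<^sup>=\<close>. The agents are \<open>{1..n}\<close>, \<open>A\<close> is the set of objects, and
  \<open>a0\<close> (not in \<open>A\<close>) is the outside option. Functions with domain \<open>{1..n}\<close> (profiles,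
  allocations) are extensional, so that equality of such functions is equality on \<open>{1..n}\<close>.
\<close>

type_synonym 'a pref = "('a \<times> 'a) set"
type_synonym 'a profile = "nat \<Rightarrow> 'a pref"
type_synonym 'a alloc = "nat \<Rightarrow> 'a"

definition strict_orders :: "'b set \<Rightarrow> 'b rel set" where
  "strict_orders X = {P. P \<subseteq> X \<times> X \<and> strict_linear_order_on X P}"

definition all_acceptable_orders :: "'a set \<Rightarrow> 'a \<Rightarrow> 'a pref set" where
  "all_acceptable_orders A a0 = {P \<in> strict_orders (insert a0 A). \<forall>a\<in>A. (a, a0) \<in> P}"

text \<open>A product domain is given by its family \<open>Ps\<close> of factors.\<close>

definition profiles :: "nat \<Rightarrow> (nat \<Rightarrow> 'a pref set) \<Rightarrow> 'a profile set" where
  "profiles n Ps = (\<Pi>\<^sub>E i\<in>{1..n}. Ps i)"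

definition allocations :: "nat \<Rightarrow> 'a set \<Rightarrow> 'a \<Rightarrow> 'a alloc set" where
  "allocations n A a0 =
     {\<mu> \<in> {1..n} \<rightarrow>\<^sub>E insert a0 A. \<forall>a\<in>A. card {i \<in> {1..n}. \<mu> i = a} \<le> 1}"

text \<open>The top element of \<open>X\<close>; used for preferences and, as \<open>\<tau>\<close>, for priorities.\<close>

definition best :: "'b rel \<Rightarrow> 'b set \<Rightarrow> 'b" where
  "best P X = (THE x. x \<in> X \<and> (\<forall>y\<in>X. y \<noteq> x \<longrightarrow> (x, y) \<in> P))"


section \<open>The fixed priority top trading cycles rule\<close>

text \<open>\<open>N'\<close> and \<open>A'\<close> are the sets of agents and objects remaining at the current step.\<close>

definition points_to ::
    "'a \<Rightarrow> ('a \<Rightarrow> nat rel) \<Rightarrow> 'a profile \<Rightarrow> nat set \<Rightarrow> 'a set \<Rightarrow> nat \<Rightarrow> nat" where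
  "points_to a0 prio P N' A' i =
     (if \<exists>a\<in>A'. (a, a0) \<in> P i
      then best (prio (best (P i) {a \<in> A'. (a, a0) \<in> P i})) N'
      else i)"

definition on_cycle ::
    "'a \<Rightarrow> ('a \<Rightarrow> nat rel) \<Rightarrow> 'a profile \<Rightarrow> nat set \<Rightarrow> 'a set \<Rightarrow> nat set" where
  "on_cycle a0 prio P N' A' =
     {i \<in> N'. (i, i) \<in> {(j, points_to a0 prio P N' A' j) | j. j \<in> N'}\<^sup>+}"

fun fpttc_step ::
    "'a \<Rightarrow> ('a \<Rightarrow> nat rel) \<Rightarrow> 'a profile
       \<Rightarrow> nat set \<times> 'a set \<times> 'a alloc \<Rightarrow> nat set \<times> 'a set \<times> 'a alloc" where
  "fpttc_step a0 prio P (N', A', \<mu>) =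
     (let C = on_cycle a0 prio P N' A';
          top = (\<lambda>i. best (P i) (insert a0 A'))
      in (N' - C, A' - top ` C, \<lambda>i. if i \<in> C then top i else \<mu> i))"

definition fpttc :: "nat \<Rightarrow> 'a set \<Rightarrow> 'a \<Rightarrow> ('a \<Rightarrow> nat rel) \<Rightarrow> 'a profile \<Rightarrow> 'a alloc" where
  "fpttc n A a0 prio P =
     snd (snd (while (\<lambda>(N', A', \<mu>). N' \<noteq> {} \<and> A' \<noteq> {}) (fpttc_step a0 prio P)
                 ({1..n}, A, restrict (\<lambda>_. a0) {1..n})))"


section \<open>Mechanisms\<close>

record ('v, 'a) mechanism =
  nodes :: "'v set"
  edges :: "('v \<times> 'v) set"
  root_node :: 'v
  leaf_alloc :: "'v \<Rightarrow> 'a alloc"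
  mover :: "'v \<Rightarrow> nat"
  edge_prefs :: "'v \<times> 'v \<Rightarrow> 'a pref set"

definition out_edges :: "('v, 'a) mechanism \<Rightarrow> 'v \<Rightarrow> ('v \<times> 'v) set" where
  "out_edges G v = {e \<in> edges G. fst e = v}"

definition leaves :: "('v, 'a) mechanism \<Rightarrow> 'v set" where
  "leaves G = {v \<in> nodes G. out_edges G v = {}}"

definition inner_nodes :: "('v, 'a) mechanism \<Rightarrow> 'v set" where
  "inner_nodes G = nodes G - leaves G"

definition is_path :: "('v, 'a) mechanism \<Rightarrow> 'v list \<Rightarrow> bool" where
  "is_path G vs \<longleftrightarrow>
     vs \<noteq> [] \<and> set vs \<subseteq> nodes G \<and> successively (\<lambda>u v. (u, v) \<in> edges G) vs"

definition root_path :: "('v, 'a) mechanism \<Rightarrow> 'v \<Rightarrow> 'v list \<Rightarrow> bool" where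
  "root_path G v vs \<longleftrightarrow> is_path G vs \<and> hd vs = root_node G \<and> last vs = v"

text \<open>
  Since \<open>is_path\<close> does not forbid repeated nodes, uniqueness of the path from the root to each
  node rules out cycles, edges into the root and several edges into the same node. Trees are
  finite: for a mechanism in which every profile determines a root-to-leaf path, this is automatic,
  as the edge labels are nonempty, pairwise disjoint at each node and, for each agent, nested along
  a path, and there are finitely many preferences.
\<close>

definition is_rooted_tree :: "('v, 'a) mechanism \<Rightarrow> bool" where
  "is_rooted_tree G \<longleftrightarrow>
     finite (nodes G) \<and> edges G \<subseteq> nodes G \<times> nodes G \<and> root_node G \<in> nodes G \<and>
     (\<forall>v\<in>nodes G. \<exists>!vs. root_path G v vs)"

text \<open>
  \<open>last_move G vs k\<close>: \<open>k\<close> is the position of the last node of \<open>vs\<close> before its final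
  node at which the agent moving at the final node also moves.
\<close>

definition last_move :: "('v, 'a) mechanism \<Rightarrow> 'v list \<Rightarrow> nat \<Rightarrow> bool" where
  "last_move G vs k \<longleftrightarrow>
     k < length vs - 1 \<and> mover G (vs ! k) = mover G (last vs) \<and>
     (\<forall>s. k < s \<and> s < length vs - 1 \<longrightarrow> mover G (vs ! s) \<noteq> mover G (last vs))"

definition is_mechanism ::
    "nat \<Rightarrow> 'a set \<Rightarrow> 'a \<Rightarrow> (nat \<Rightarrow> 'a pref set) \<Rightarrow> ('v, 'a) mechanism \<Rightarrow> bool" where
  "is_mechanism n A a0 Ps G \<longleftrightarrow>
     is_rooted_tree G \<and>
     (\<forall>v\<in>leaves G. leaf_alloc G v \<in> allocations n A a0) \<and>
     (\<forall>v\<in>inner_nodes G. mover G v \<in> {1..n}) \<and>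
     (\<forall>e\<in>edges G. edge_prefs G e \<noteq> {} \<and> edge_prefs G e \<subseteq> strict_orders (insert a0 A)) \<and>
     (\<forall>e\<in>edges G. \<forall>e'\<in>edges G.
        fst e = fst e' \<and> e \<noteq> e' \<longrightarrow> edge_prefs G e \<inter> edge_prefs G e' = {}) \<and>
     (\<forall>v\<in>inner_nodes G. \<forall>vs. root_path G v vs \<longrightarrow>
        (\<forall>k. last_move G vs k \<longrightarrow>
           (\<Union>e\<in>out_edges G v. edge_prefs G e) = edge_prefs G (vs ! k, vs ! Suc k)) \<and>
        ((\<nexists>k. last_move G vs k) \<longrightarrow>
           (\<Union>e\<in>out_edges G v. edge_prefs G e) = Ps (mover G v)))"

definition is_play :: "('v, 'a) mechanism \<Rightarrow> 'a profile \<Rightarrow> 'v list \<Rightarrow> bool" where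
  "is_play G P vs \<longleftrightarrow>
     is_path G vs \<and> hd vs = root_node G \<and> last vs \<in> leaves G \<and>
     (\<forall>k. Suc k < length vs \<longrightarrow> P (mover G (vs ! k)) \<in> edge_prefs G (vs ! k, vs ! Suc k))"

definition play :: "('v, 'a) mechanism \<Rightarrow> 'a profile \<Rightarrow> 'v list" where
  "play G P = (THE vs. is_play G P vs)"

definition passes :: "('v, 'a) mechanism \<Rightarrow> 'a profile \<Rightarrow> 'v \<Rightarrow> bool" where
  "passes G P v \<longleftrightarrow> v \<in> set (play G P)"

definition result :: "('v, 'a) mechanism \<Rightarrow> 'a profile \<Rightarrow> 'a alloc" where
  "result G P = leaf_alloc G (last (play G P))"

definition diverge :: "('v, 'a) mechanism \<Rightarrow> nat \<Rightarrow> 'v \<Rightarrow> 'a pref \<Rightarrow> 'a pref \<Rightarrow> bool" where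
  "diverge G i v Q Q' \<longleftrightarrow>
     mover G v = i \<and>
     (\<exists>e\<in>out_edges G v. \<exists>e'\<in>out_edges G v. e \<noteq> e' \<and> Q \<in> edge_prefs G e \<and> Q' \<in> edge_prefs G e')"


section \<open>Simplicity and strategy-proofness\<close>

definition osp :: "nat \<Rightarrow> (nat \<Rightarrow> 'a pref set) \<Rightarrow> ('v, 'a) mechanism \<Rightarrow> bool" where
  "osp n Ps G \<longleftrightarrow>
     (\<forall>i\<in>{1..n}. \<forall>v\<in>inner_nodes G. mover G v = i \<longrightarrow>
       (\<forall>P\<in>profiles n Ps. \<forall>Pt\<in>profiles n Ps.
          passes G P v \<and> passes G Pt v \<and> diverge G i v (P i) (Pt i) \<longrightarrow>
          (result G P i, result G Pt i) \<in> (P i)\<^sup>=))"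

definition sosp :: "nat \<Rightarrow> (nat \<Rightarrow> 'a pref set) \<Rightarrow> ('v, 'a) mechanism \<Rightarrow> bool" where
  "sosp n Ps G \<longleftrightarrow>
     (\<forall>i\<in>{1..n}. \<forall>v\<in>inner_nodes G. mover G v = i \<longrightarrow>
       (\<forall>P\<in>profiles n Ps. \<forall>P'\<in>profiles n Ps. \<forall>Pt\<in>profiles n Ps.
          passes G P v \<and> passes G P' v \<and> passes G Pt v \<and>
          \<not> diverge G i v (P i) (P' i) \<and> diverge G i v (P i) (Pt i) \<longrightarrow>
          (result G P' i, result G Pt i) \<in> (P i)\<^sup>=))"

definition simple :: "('v, 'a) mechanism \<Rightarrow> bool" where
  "simple G \<longleftrightarrow>
     (\<forall>vs. is_path G vs \<longrightarrow>
        (\<forall>v\<in>set vs \<inter> inner_nodes G. \<forall>v'\<in>set vs \<inter> inner_nodes G.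
           v \<noteq> v' \<longrightarrow> mover G v \<noteq> mover G v'))"

text \<open>
  The nodes of the implementing mechanism are natural numbers, which is no restriction since the
  tree is finite.
\<close>

definition sosp_implementable ::
    "nat \<Rightarrow> 'a set \<Rightarrow> 'a \<Rightarrow> (nat \<Rightarrow> 'a pref set) \<Rightarrow> ('a profile \<Rightarrow> 'a alloc) \<Rightarrow> bool" where
  "sosp_implementable n A a0 Ps f \<longleftrightarrow>
     (\<exists>G :: (nat, 'a) mechanism. is_mechanism n A a0 Ps G \<and> sosp n Ps G \<and>
        (\<forall>P\<in>profiles n Ps. f P = result G P))"

definition simply_strategy_proof ::
    "nat \<Rightarrow> 'a set \<Rightarrow> 'a \<Rightarrow> (nat \<Rightarrow> 'a pref set) \<Rightarrow> ('a profile \<Rightarrow> 'a alloc) \<Rightarrow> bool" where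
  "simply_strategy_proof n A a0 Ps f \<longleftrightarrow>
     (\<exists>G :: (nat, 'a) mechanism. is_mechanism n A a0 Ps G \<and> simple G \<and> osp n Ps G \<and>
        (\<forall>P\<in>profiles n Ps. f P = result G P))"

end

theory Submission
  imports Defs "HOL-Library.Disjoint_Sets" "HOL-Library.Nat_Bijection" "HOL-Library.Sublist"
begin

text \<open>
  In a simple mechanism a player who moves at \<open>v\<close> moves nowhere else on a play through \<open>v\<close>, so her
  preference can be replaced by any other one in the same class at \<open>v\<close> without changing the play.
  Hence a simple OSP mechanism is SOSP.

  Conversely, consider the first node of an SOSP mechanism at which a player \<open>i\<close> makes a choice that
  can affect her assignment. All her preferences are still possible, and the domain is so rich that
  within each class of the partition all preferences agree on the objects she can still get. By SOSP,
  at any later node of \<open>i\<close> with a proper choice, her assignment is already determined. As FPTTC is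
  nonbossy, such nodes do not affect the outcome at all and can be contracted, which leaves a
  simple mechanism.

  Nonbossiness holds because the cycles of the FPTTC graph can be removed in any order: one first
  removes the cycles avoiding \<open>i\<close>, which do not depend on her preference.
\<close>

section \<open>Nonbossiness of the FPTTC rule\<close>

text \<open>Mechanisms as labelled graphs, with labels that refer back to the mover's last move, are
  awkward to transform. For the converse direction a node is therefore replaced by the box of
  profiles passing through it; \<open>sosp_game\<close> and \<open>simple_game\<close> are defined
  on boxes, and mechanisms appear only at the two ends of the argument. The obstacle to simplicity
  is an agent who moves again after her choice. That her own assignment is settled does not make the
  later move harmless, as it might still steer the assignments of others; this is what nonbossiness
  excludes. A contracted node is replaced by the game after any one of its classes, which then
  serves the whole box. Contraction also has to preserve the richness of the factors. Dropping a
  node with one class leaves the box unchanged, and an agent whose node is contracted because her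
  assignment is constant is from then on treated as if she had moved. So whenever a choice is kept,
  the mover's factor is still the whole domain, which contains the lifted order that refutes a
  disagreement within a class.\<close>

lemma finite_image_eq_inj: "finite C \<Longrightarrow> \<pi> ` C = C \<Longrightarrow> inj_on \<pi> C"
  by (simp add: eq_card_imp_inj_on)

text \<open>This is \<open>on_cycle\<close> with the pointing map abstracted. For a finite
  \<open>V\<close> that \<pi> maps into itself it is the largest subset that \<pi> maps onto itself,
  so unions of cycles can be handled as invariant sets without naming any single cycle.\<close>

definition cyclic :: "'b set \<Rightarrow> ('b \<Rightarrow> 'b) \<Rightarrow> 'b set" where
  "cyclic V \<pi> = {i \<in> V. (i, i) \<in> {(j, \<pi> j) | j. j \<in> V}\<^sup>+}"

text \<open>By finiteness \<pi> permutes \<open>C\<close>. With \<open>R\<close> the set of points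
  reached from \<open>i\<close> in at least one step, \<pi> maps \<open>insert i R\<close>
  injectively into \<open>R\<close>; counting then forces \<open>i\<close> into
  \<open>R\<close>.\<close>

lemma subset_cyclic:
  assumes "finite V" "C \<subseteq> V" "\<pi> ` C = C"
  shows "C \<subseteq> cyclic V \<pi>"
proof
  fix i assume i: "i \<in> C"
  define r where "r = {(j, \<pi> j) | j. j \<in> V}"
  define R where "R = {x. (i, x) \<in> r\<^sup>+}"
  have fin: "finite C" using assms finite_subset by blast
  have "x \<in> C" if "(i, x) \<in> r\<^sup>+" for x
    using that by (induction rule: trancl_induct) (use i assms(3) in \<open>auto simp: r_def\<close>)
  then have RC: "R \<subseteq> C" by (auto simp: R_def)
  have finR: "finite R" using RC fin finite_subset by blast
  have edge: "(x, \<pi> x) \<in> r" if "x \<in> C" for x using that assms(2) by (auto simp: r_def)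
  have "\<pi> ` insert i R \<subseteq> R"
    using edge i RC by (auto simp: R_def intro: trancl_into_trancl r_into_trancl)
  moreover have "inj_on \<pi> (insert i R)"
    using finite_image_eq_inj[OF fin assms(3)] by (rule inj_on_subset) (use i RC in simp)
  ultimately have "card (insert i R) \<le> card R" using finR by (metis card_image card_mono)
  then have "i \<in> R" using finR by (metis card_insert_disjoint not_less_eq_eq order_refl)
  then show "i \<in> cyclic V \<pi>" using i assms(2) by (auto simp: cyclic_def R_def r_def)
qed

lemma image_cyclic:
  assumes "\<pi> ` V \<subseteq> V"
  shows "\<pi> ` cyclic V \<pi> = cyclic V \<pi>"
proof
  let ?r = "{(j, \<pi> j) | j. j \<in> V}"
  show "\<pi> ` cyclic V \<pi> \<subseteq> cyclic V \<pi>"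
  proof
    fix y assume "y \<in> \<pi> ` cyclic V \<pi>"
    then obtain i where i: "i \<in> V" "(i, i) \<in> ?r\<^sup>+" "y = \<pi> i" by (auto simp: cyclic_def)
    then obtain z where "(i, z) \<in> ?r" "(z, i) \<in> ?r\<^sup>*" by (meson tranclD)
    then have "(y, i) \<in> ?r\<^sup>*" using i by auto
    moreover have "(i, y) \<in> ?r" using i by auto
    ultimately show "y \<in> cyclic V \<pi>"
      using i assms by (auto simp: cyclic_def intro: rtrancl_into_trancl1)
  qed
  show "cyclic V \<pi> \<subseteq> \<pi> ` cyclic V \<pi>"
  proof
    fix i assume "i \<in> cyclic V \<pi>"
    then have i: "i \<in> V" "(i, i) \<in> ?r\<^sup>+" by (auto simp: cyclic_def)
    then obtain z where z: "(i, z) \<in> ?r\<^sup>*" "(z, i) \<in> ?r" by (meson tranclD2)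
    then have "(z, z) \<in> ?r\<^sup>+" by (meson rtrancl_into_trancl2)
    then show "i \<in> \<pi> ` cyclic V \<pi>" using z by (auto simp: cyclic_def)
  qed
qed

text \<open>A nonempty closed set of least cardinality is mapped onto itself, because its image is
  again nonempty and closed.\<close>

lemma cyclic_nonempty:
  assumes "finite V" "V \<noteq> {}" "\<pi> ` V \<subseteq> V"
  shows "cyclic V \<pi> \<noteq> {}"
proof -
  let ?closed = "\<lambda>M. M \<noteq> {} \<and> M \<subseteq> V \<and> \<pi> ` M \<subseteq> M"
  obtain M where M: "?closed M" and min: "\<And>M'. ?closed M' \<Longrightarrow> card M \<le> card M'"
    using ex_has_least_nat[of ?closed V card] assms by blast
  have "finite M" using M assms finite_subset by blast
  have "card M \<le> card (\<pi> ` M)" using M by (intro min) auto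
  then have "\<pi> ` M = M" using M \<open>finite M\<close> by (metis card_seteq)
  then show ?thesis using subset_cyclic[of V M \<pi>] M assms by auto
qed

section \<open>Maxima of strict linear orders\<close>

lemma strict_ordersD:
  assumes "P \<in> strict_orders B"
  shows "P \<subseteq> B \<times> B" "(x, y) \<in> P \<Longrightarrow> (y, x) \<notin> P" "(x, x) \<notin> P"
    "(x, y) \<in> P \<Longrightarrow> (y, z) \<in> P \<Longrightarrow> (x, z) \<in> P"
    "x \<in> B \<Longrightarrow> y \<in> B \<Longrightarrow> x \<noteq> y \<Longrightarrow> (x, y) \<in> P \<or> (y, x) \<in> P"
  using assms unfolding strict_orders_def strict_linear_order_on_def irrefl_def total_on_def
  by (blast dest: transD)+

lemma best_eqI:
  assumes "P \<in> strict_orders B" "x \<in> X" "\<And>y. y \<in> X \<Longrightarrow> y \<noteq> x \<Longrightarrow> (x, y) \<in> P"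
  shows "best P X = x"
  unfolding best_def
proof (rule the_equality)
  fix z assume "z \<in> X \<and> (\<forall>y\<in>X. y \<noteq> z \<longrightarrow> (z, y) \<in> P)"
  then show "z = x" using assms(2,3) strict_ordersD(2)[OF assms(1)] by metis
qed (use assms in auto)

lemma best_exists:
  assumes "P \<in> strict_orders B" "finite X" "X \<noteq> {}" "X \<subseteq> B"
  shows "\<exists>x\<in>X. \<forall>y\<in>X. y \<noteq> x \<longrightarrow> (x, y) \<in> P"
  using assms(2-4)
proof (induction rule: finite_ne_induct)
  case (insert z X)
  then obtain x where x: "x \<in> X" "\<forall>y\<in>X. y \<noteq> x \<longrightarrow> (x, y) \<in> P" by auto
  have P: "trans P" "total_on B P"
    using assms(1) by (auto simp: strict_orders_def strict_linear_order_on_def)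
  consider "(x, z) \<in> P" | "(z, x) \<in> P"
    using P(2) x(1) insert.hyps insert.prems unfolding total_on_def by (metis insert_subset subsetD)
  then show ?case
  proof cases
    case 2
    then have "\<forall>y\<in>X. (z, y) \<in> P" using x P(1) by (metis transD)
    then show ?thesis by auto
  qed (use x in auto)
qed auto

lemma
  assumes "P \<in> strict_orders B" "finite X" "X \<noteq> {}" "X \<subseteq> B"
  shows best_in: "best P X \<in> X"
    and best_above: "y \<in> X \<Longrightarrow> y \<noteq> best P X \<Longrightarrow> (best P X, y) \<in> P"
  using best_exists[OF assms] best_eqI[OF assms(1)] by metis+

text \<open>This keeps the graph stable when objects and agents leave the market: favourites and
  owners do not change while they survive.\<close>

lemma best_subset_eq:
  assumes "P \<in> strict_orders B" "finite X" "X \<subseteq> B" "Y \<subseteq> X" "best P X \<in> Y"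
  shows "best P Y = best P X"
proof (rule best_eqI[OF assms(1,5)])
  fix y assume "y \<in> Y" "y \<noteq> best P X"
  then show "(best P X, y) \<in> P" using best_above[OF assms(1,2) _ assms(3)] assms(4) by auto
qed

section \<open>Top trading cycles from an arbitrary intermediate state\<close>

locale market =
  fixes n :: nat and A :: "'a set" and a0 :: 'a and prio :: "'a \<Rightarrow> nat rel"
  assumes finite_A: "finite A" and a0_notin: "a0 \<notin> A"
    and prio: "a \<in> A \<Longrightarrow> prio a \<in> strict_orders {1..n}"
begin

abbreviation favourite :: "'a profile \<Rightarrow> 'a set \<Rightarrow> nat \<Rightarrow> 'a" where
  "favourite P A' i \<equiv> best (P i) (insert a0 A')"

abbreviation pt :: "'a profile \<Rightarrow> nat set \<Rightarrow> 'a set \<Rightarrow> nat \<Rightarrow> nat" where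
  "pt \<equiv> points_to a0 prio"

text \<open>The loop of \<open>fpttc\<close> with its initial state left free, since the arguments
  below are inductions on the number of remaining agents.\<close>

definition ttc :: "'a profile \<Rightarrow> nat set \<Rightarrow> 'a set \<Rightarrow> 'a alloc \<Rightarrow> 'a alloc" where
  "ttc P N' A' \<mu> = snd (snd (while (\<lambda>(N', A', \<mu>). N' \<noteq> {} \<and> A' \<noteq> {}) (fpttc_step a0 prio P)
     (N', A', \<mu>)))"

definition assign :: "'a profile \<Rightarrow> 'a set \<Rightarrow> nat set \<Rightarrow> 'a alloc \<Rightarrow> 'a alloc" where
  "assign P A' C \<mu> = (\<lambda>i. if i \<in> C then favourite P A' i else \<mu> i)"

abbreviation ttc_after :: "'a profile \<Rightarrow> nat set \<Rightarrow> 'a set \<Rightarrow> 'a alloc \<Rightarrow> nat set \<Rightarrow> 'a alloc" where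
  "ttc_after P N' A' \<mu> C \<equiv> ttc P (N' - C) (A' - favourite P A' ` C) (assign P A' C \<mu>)"

definition wf_market :: "'a profile \<Rightarrow> nat set \<Rightarrow> 'a set \<Rightarrow> bool" where
  "wf_market P N' A' \<longleftrightarrow> N' \<subseteq> {1..n} \<and> A' \<subseteq> A \<and> (\<forall>i\<in>N'. P i \<in> strict_orders (insert a0 A))"

lemma wf_market_finite: "wf_market P N' A' \<Longrightarrow> finite N'" "wf_market P N' A' \<Longrightarrow> finite A'"
  using finite_A by (auto simp: wf_market_def intro: finite_subset)

lemma wf_market_diff: "wf_market P N' A' \<Longrightarrow> wf_market P (N' - C) (A' - X)"
  by (auto simp: wf_market_def)

lemma ttc_empty: "N' = {} \<or> A' = {} \<Longrightarrow> ttc P N' A' \<mu> = \<mu>"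
  unfolding ttc_def by (subst while_unfold) auto

lemma ttc_step:
  assumes "N' \<noteq> {}" "A' \<noteq> {}"
  shows "ttc P N' A' \<mu> = ttc_after P N' A' \<mu> (cyclic N' (pt P N' A'))"
  using assms unfolding ttc_def assign_def
  by (subst while_unfold) (simp add: Let_def on_cycle_def cyclic_def)

lemma favourite_in:
  "wf_market P N' A' \<Longrightarrow> i \<in> N' \<Longrightarrow> favourite P A' i \<in> insert a0 A'"
  using wf_market_finite by (intro best_in[where B = "insert a0 A"]) (auto simp: wf_market_def)

text \<open>\<open>points_to\<close> maximises over acceptable objects, \<open>fpttc_step\<close>
  over all remaining objects and \<open>a0\<close>. They agree because the latter maximum is
  \<open>a0\<close> exactly if nothing acceptable remains. Hence the graph depends on preferences
  only through favourites.\<close>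

lemma points_to_favourite:
  assumes "wf_market P N' A'" "i \<in> N'"
  shows "pt P N' A' i =
    (if favourite P A' i = a0 then i else best (prio (favourite P A' i)) N')"
proof -
  let ?f = "favourite P A' i" and ?X = "{a \<in> A'. (a, a0) \<in> P i}"
  have P: "P i \<in> strict_orders (insert a0 A)" and sub: "A' \<subseteq> A" and fin: "finite A'"
    using assms wf_market_finite by (auto simp: wf_market_def)
  have above: "y \<in> insert a0 A' \<Longrightarrow> y \<noteq> ?f \<Longrightarrow> (?f, y) \<in> P i" for y
    using best_above[OF P, of "insert a0 A'"] fin sub by auto
  show ?thesis
  proof (cases "?f = a0")
    case True
    then have "\<not> (\<exists>a\<in>A'. (a, a0) \<in> P i)"
      using above strict_ordersD(2,3)[OF P] by (metis insertI2)
    then show ?thesis using True by (simp add: points_to_def)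
  next
    case False
    then have "?f \<in> ?X" using favourite_in[OF assms] above by auto
    moreover from this have "best (P i) ?X = ?f"
      using best_subset_eq[OF P, of "insert a0 A'" ?X] fin sub by auto
    ultimately show ?thesis using False by (auto simp: points_to_def)
  qed
qed

lemma points_to_in:
  assumes "wf_market P N' A'" "i \<in> N'"
  shows "pt P N' A' i \<in> N'"
proof (cases "favourite P A' i = a0")
  case False
  then have "favourite P A' i \<in> A" using favourite_in[OF assms] assms by (auto simp: wf_market_def)
  then show ?thesis
    using points_to_favourite[OF assms] False assms wf_market_finite
    by (auto simp: wf_market_def intro!: best_in[OF prio])
qed (use points_to_favourite[OF assms] assms in auto)

text \<open>If the favourite of \<open>i\<close> left with some \<open>c\<close> in
  \<open>C\<close>, then \<open>c\<close> and \<open>i\<close> would point to the same owner, who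
  lies in \<open>C\<close>, against the assumption on \<open>i\<close>. So the favourite stays, and
  its owner, being outside \<open>C\<close>, keeps top priority for it.\<close>

lemma survivor_unaffected:
  assumes wf: "wf_market P N' A'" and C: "C \<subseteq> N'" "pt P N' A' ` C = C"
    and i: "i \<in> N'" "i \<notin> C" "pt P N' A' i \<notin> C"
  defines "A'' \<equiv> A' - favourite P A' ` C"
  shows "favourite P A'' i = favourite P A' i" "pt P (N' - C) A'' i = pt P N' A' i"
proof -
  let ?f = "favourite P A' i"
  have P: "P i \<in> strict_orders (insert a0 A)" using wf i by (auto simp: wf_market_def)
  have wf': "wf_market P (N' - C) A''" using wf_market_diff[OF wf] by (simp add: A''_def)
  have fin: "finite A'" "finite N'" using wf_market_finite wf by auto
  have sub: "A' \<subseteq> A" "N' \<subseteq> {1..n}" using wf by (auto simp: wf_market_def)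
  have notin: "?f \<notin> favourite P A' ` C" if "?f \<noteq> a0"
  proof
    assume "?f \<in> favourite P A' ` C"
    then obtain c where c: "c \<in> C" "favourite P A' c = ?f" by auto
    then have "pt P N' A' c = pt P N' A' i"
      using points_to_favourite[OF wf] that i C by auto
    then show False using c C(2) i(3) by (metis imageI)
  qed
  have "?f \<in> insert a0 A''" using favourite_in[OF wf i(1)] notin by (auto simp: A''_def)
  then show eq: "favourite P A'' i = ?f"
    using best_subset_eq[OF P, of "insert a0 A'" "insert a0 A''"] fin sub by (auto simp: A''_def)
  show "pt P (N' - C) A'' i = pt P N' A' i"
  proof (cases "?f = a0")
    case True
    then show ?thesis using points_to_favourite[OF wf] points_to_favourite[OF wf'] eq i by auto
  next
    case False
    have "?f \<in> A" using favourite_in[OF wf i(1)] False sub by auto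
    moreover have "best (prio ?f) N' \<in> N' - C"
      using points_to_in[OF wf i(1)] points_to_favourite[OF wf i(1)] i False by auto
    ultimately have "best (prio ?f) (N' - C) = best (prio ?f) N'"
      using best_subset_eq[OF prio, of ?f N' "N' - C"] fin sub by auto
    then show ?thesis
      using points_to_favourite[OF wf] points_to_favourite[OF wf'] eq i False by auto
  qed
qed

text \<open>Removing only some of the cycles of the first step does not change the outcome, because
  the remaining cycles survive until the next step.\<close>

lemma ttc_remove_cycles:
  assumes "wf_market P N' A'" "C \<subseteq> N'" "pt P N' A' ` C = C" "\<And>i. i \<in> N' \<Longrightarrow> \<mu> i = a0"
  shows "ttc P N' A' \<mu> = ttc_after P N' A' \<mu> C"
  using assms
proof (induction "card N'" arbitrary: N' A' \<mu> C rule: less_induct)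
  case less
  note wf = less.prems(1) and CN = less.prems(2) and C = less.prems(3) and \<mu> = less.prems(4)
  note fin = wf_market_finite[OF wf]
  consider "C = {}" | "A' = {}" | "C \<noteq> {}" "A' \<noteq> {}" by blast
  then show ?case
  proof cases
    case 1
    then show ?thesis by (simp add: assign_def)
  next
    case 2
    \<comment> \<open>The loop has already stopped here, whereas \<open>assign\<close> still writes
      \<open>a0\<close>. This changes nothing because \<mu> holds \<open>a0\<close> for every
      remaining agent.\<close>
    have "favourite P A' i = a0" if "i \<in> N'" for i using favourite_in[OF wf that] 2 by simp
    then have "assign P A' C \<mu> i = \<mu> i" for i using \<mu> CN by (cases "i \<in> C") (auto simp: assign_def)
    then have "assign P A' C \<mu> = \<mu>" by blast
    then show ?thesis using 2 by (simp add: ttc_empty)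
  next
    case 3
    let ?Z = "cyclic N' (pt P N' A')"
    define N2 A2 \<mu>2 where "N2 = N' - C" and "A2 = A' - favourite P A' ` C"
      and "\<mu>2 = assign P A' C \<mu>"
    have ZN: "?Z \<subseteq> N'" by (auto simp: cyclic_def)
    have CZ: "C \<subseteq> ?Z" by (rule subset_cyclic[OF fin(1) CN C])
    have Z: "pt P N' A' ` ?Z = ?Z" by (rule image_cyclic) (use points_to_in[OF wf] in auto)
    have inj: "inj_on (pt P N' A') ?Z"
      by (rule finite_image_eq_inj[OF finite_subset[OF ZN fin(1)] Z])
    \<comment> \<open>Injectivity makes \<open>?Z - C\<close> invariant too: it consists of the
      other cycles.\<close>
    have diff: "pt P N' A' ` (?Z - C) = ?Z - C"
      using inj_on_image_set_diff[OF inj, of ?Z C] CZ C Z by auto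
    have same: "favourite P A2 i = favourite P A' i" "pt P N2 A2 i = pt P N' A' i"
      if "i \<in> ?Z - C" for i
      using survivor_unaffected[OF wf CN C, of i] that ZN diff by (auto simp: N2_def A2_def)
    \<comment> \<open>The induction hypothesis is applied to the market left by \<open>C\<close>,
      with the other cycles \<open>?Z - C\<close> as the set to remove. Both removals together lead
      to the state after the full first step.\<close>
    have "ttc P N2 A2 \<mu>2 = ttc_after P N2 A2 \<mu>2 (?Z - C)"
    proof (rule less.hyps)
      show "card N2 < card N'" unfolding N2_def using fin CN 3 by (intro psubset_card_mono) auto
      show "wf_market P N2 A2" unfolding N2_def A2_def using wf by (rule wf_market_diff)
      have "pt P N2 A2 ` (?Z - C) = pt P N' A' ` (?Z - C)" using same(2) by (rule image_cong[OF refl])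
      then show "pt P N2 A2 ` (?Z - C) = ?Z - C" using diff by simp
    qed (use ZN \<mu> in \<open>auto simp: N2_def \<mu>2_def assign_def\<close>)
    also have "N2 - (?Z - C) = N' - ?Z" using CZ by (auto simp: N2_def)
    also have "favourite P A2 ` (?Z - C) = favourite P A' ` (?Z - C)"
      using same(1) by (rule image_cong[OF refl])
    also have "A2 - favourite P A' ` (?Z - C) = A' - favourite P A' ` ?Z"
      using CZ by (auto simp: A2_def)
    also have "assign P A2 (?Z - C) \<mu>2 = assign P A' ?Z \<mu>"
      using same(1) CZ by (auto simp: \<mu>2_def assign_def fun_eq_iff)
    finally show ?thesis
      using ttc_step[of N' A' P \<mu>] 3 CN by (auto simp: N2_def A2_def \<mu>2_def)
  qed
qed

lemma cyclic_points_to_ne: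
  "wf_market P N' A' \<Longrightarrow> N' \<noteq> {} \<Longrightarrow> cyclic N' (pt P N' A') \<noteq> {}"
  by (rule cyclic_nonempty) (use points_to_in wf_market_finite in auto)

lemma ttc_cong:
  assumes "wf_market P N' A'" "\<And>i. i \<in> N' \<Longrightarrow> P i = P' i"
  shows "ttc P N' A' \<mu> = ttc P' N' A' \<mu>"
  using assms
proof (induction "card N'" arbitrary: N' A' \<mu> rule: less_induct)
  case less
  show ?case
  proof (cases "N' = {} \<or> A' = {}")
    case False
    let ?Z = "cyclic N' (pt P N' A')"
    have ZN: "?Z \<subseteq> N'" by (auto simp: cyclic_def)
    have "pt P N' A' i = pt P' N' A' i" if "i \<in> N'" for i
      using less.prems(2)[OF that] by (simp add: points_to_def)
    then have Z: "cyclic N' (pt P' N' A') = ?Z"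
      by (auto simp: cyclic_def intro: arg_cong[where f = "\<lambda>r. (_, _) \<in> r\<^sup>+"]) 
        (smt (verit) Collect_cong)+
    have fav: "favourite P' A' i = favourite P A' i" if "i \<in> ?Z" for i
      using less.prems(2) that ZN by auto
    have "ttc P (N' - ?Z) X \<nu> = ttc P' (N' - ?Z) X \<nu>" if "X \<subseteq> A'" for X \<nu>
    proof (rule less.hyps)
      have "finite N'" using less.prems(1) wf_market_finite by blast
      then show "card (N' - ?Z) < card N'"
        using cyclic_points_to_ne[OF less.prems(1)] False ZN by (intro psubset_card_mono) auto
      show "wf_market P (N' - ?Z) X" using less.prems(1) that by (auto simp: wf_market_def)
    qed (use less.prems(2) in auto)
    moreover have "assign P' A' ?Z \<mu> = assign P A' ?Z \<mu>" using fav by (auto simp: assign_def)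
    moreover have "favourite P' A' ` ?Z = favourite P A' ` ?Z" using fav by auto
    ultimately show ?thesis using ttc_step False Z by (metis Diff_subset)
  qed (simp add: ttc_empty)
qed

lemma ttc_assigned:
  assumes "wf_market P N' A'" "i \<notin> N'"
  shows "ttc P N' A' \<mu> i = \<mu> i"
  using assms
proof (induction "card N'" arbitrary: N' A' \<mu> rule: less_induct)
  case less
  show ?case
  proof (cases "N' = {} \<or> A' = {}")
    case False
    let ?Z = "cyclic N' (pt P N' A')"
    have ZN: "?Z \<subseteq> N'" by (auto simp: cyclic_def)
    have "finite N'" using less.prems(1) wf_market_finite by blast
    then have "card (N' - ?Z) < card N'"
      using cyclic_points_to_ne[OF less.prems(1)] False ZN by (intro psubset_card_mono) auto
    then have "ttc_after P N' A' \<mu> ?Z i = assign P A' ?Z \<mu> i"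
      using less.prems wf_market_diff by (intro less.hyps) auto
    then show ?thesis using ttc_step[of N' A' P \<mu>] False ZN less.prems(2) by (auto simp: assign_def)
  qed (simp add: ttc_empty)
qed

text \<open>Cycles avoiding \<open>i\<close> are common to both profiles and can be removed first; once none is
  left, \<open>i\<close> is on the only cycle in both, so equal assignments mean equal graphs.\<close>

lemma ttc_nonbossy:
  assumes "wf_market P N' A'" "wf_market P' N' A'" "\<And>j. j \<in> N' \<Longrightarrow> j \<noteq> i \<Longrightarrow> P j = P' j"
    "\<And>j. j \<in> N' \<Longrightarrow> \<mu> j = a0" "ttc P N' A' \<mu> i = ttc P' N' A' \<mu> i"
  shows "ttc P N' A' \<mu> = ttc P' N' A' \<mu>"
  using assms
proof (induction "card N'" arbitrary: N' A' \<mu> rule: less_induct)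
  case less
  note wf = less.prems(1,2) and P = less.prems(3) and \<mu> = less.prems(4) and i = less.prems(5)
  let ?\<pi> = "pt P N' A'" and ?\<pi>' = "pt P' N' A'"
  have fin: "finite N'" using wf wf_market_finite by blast
  have pt_eq: "?\<pi> j = ?\<pi>' j" if "j \<in> N'" "j \<noteq> i" for j
    using P[OF that] by (simp add: points_to_def)
  consider "N' = {} \<or> A' = {}" | "i \<notin> N'"
    | C where "i \<in> N'" "C \<noteq> {}" "C \<subseteq> N' - {i}" "?\<pi> ` C = C"
    | "i \<in> N'" "N' \<noteq> {}" "A' \<noteq> {}" "\<nexists>C. C \<noteq> {} \<and> C \<subseteq> N' - {i} \<and> ?\<pi> ` C = C"
    by blast
  then show ?case
  proof cases
    case 1
    then show ?thesis by (metis ttc_empty)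
  next
    case 2
    then show ?thesis using ttc_cong[OF wf(1), of P'] P by metis
  next
    case 3
    \<comment> \<open>Only the arrow of \<open>i\<close> can differ, and \<open>C\<close> avoids
      \<open>i\<close>, so \<open>C\<close> is a union of cycles in both graphs.\<close>
    have "?\<pi>' ` C = ?\<pi> ` C"
    proof (rule image_cong)
      show "?\<pi>' x = ?\<pi> x" if "x \<in> C" for x
      proof -
        have "x \<in> N'" "x \<noteq> i" using that 3(3) by auto
        then show ?thesis using pt_eq[of x] by simp
      qed
    qed simp
    then have pi: "?\<pi>' ` C = C" using 3(4) by simp
    have fav: "favourite P' A' j = favourite P A' j" if "j \<in> C" for j
      using P[of j] subsetD[OF 3(3) that] by simp
    then have im: "favourite P' A' ` C = favourite P A' ` C"
      and asg: "assign P' A' C \<mu> = assign P A' C \<mu>" by (auto simp: assign_def)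
    have 4: "ttc P N' A' \<mu> = ttc_after P N' A' \<mu> C"
      using 3 \<mu> by (intro ttc_remove_cycles[OF wf(1)]) auto
    have 5: "ttc P' N' A' \<mu> = ttc P' (N' - C) (A' - favourite P A' ` C) (assign P A' C \<mu>)"
      unfolding im[symmetric] asg[symmetric]
      using 3 \<mu> pi by (intro ttc_remove_cycles[OF wf(2)]) auto
    have "ttc_after P N' A' \<mu> C = ttc P' (N' - C) (A' - favourite P A' ` C) (assign P A' C \<mu>)"
    proof (rule less.hyps)
      show "card (N' - C) < card N'" using fin 3 by (intro psubset_card_mono) auto
      show "ttc_after P N' A' \<mu> C i = ttc P' (N' - C) (A' - favourite P A' ` C) (assign P A' C \<mu>) i"
        using i 4 5 by simp
    qed (use wf wf_market_diff P \<mu> in \<open>auto simp: assign_def\<close>)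
    then show ?thesis using 4 5 by simp
  next
    case 4
    let ?Z = "cyclic N' ?\<pi>" and ?Z' = "cyclic N' ?\<pi>'"
    have Z: "?\<pi> ` ?Z = ?Z" "?\<pi>' ` ?Z' = ?Z'"
      by (rule image_cyclic; use points_to_in[OF wf(1)] points_to_in[OF wf(2)] in auto)+
    have ne: "?Z \<noteq> {}" "?Z' \<noteq> {}" using cyclic_points_to_ne wf 4 by auto
    have ZN: "?Z \<subseteq> N'" "?Z' \<subseteq> N'" by (auto simp: cyclic_def)
    have iZ: "i \<in> ?Z" using 4(4) Z(1) ne(1) ZN(1) by blast
    \<comment> \<open>The case assumption speaks of \<open>?\<pi>\<close> only. If
      \<open>?Z'\<close> avoided \<open>i\<close>, both maps would agree on it, and it would be one
      of the sets excluded there.\<close>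
    have iZ': "i \<in> ?Z'"
    proof (rule ccontr)
      assume "i \<notin> ?Z'"
      then have sub: "?Z' \<subseteq> N' - {i}" using ZN by blast
      then have "?\<pi> ` ?Z' = ?\<pi>' ` ?Z'" using pt_eq by (intro image_cong) auto
      then have "?\<pi> ` ?Z' = ?Z'" using Z(2) by simp
      then show False using 4(4) sub ne(2) by blast
    qed
    have st: "ttc P N' A' \<mu> = ttc_after P N' A' \<mu> ?Z" "ttc P' N' A' \<mu> = ttc_after P' N' A' \<mu> ?Z'"
      using ttc_step 4 by blast+
    \<comment> \<open>\<open>i\<close> leaves in this step under both profiles, so the equality of
      her final assignments is an equality of current favourites.\<close>
    have "ttc_after P N' A' \<mu> ?Z i = favourite P A' i" "ttc_after P' N' A' \<mu> ?Z' i = favourite P' A' i"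
      using ttc_assigned[OF wf_market_diff] wf iZ iZ' by (auto simp: assign_def)
    then have fi: "favourite P A' i = favourite P' A' i" using i st by simp
    have fav: "favourite P A' j = favourite P' A' j" if "j \<in> N'" for j
      using fi P that by (cases "j = i") auto
    have "?\<pi> j = ?\<pi>' j" if "j \<in> N'" for j
      using that fav points_to_favourite[OF wf(1)] points_to_favourite[OF wf(2)] by auto
    then have "{(j, ?\<pi> j) | j. j \<in> N'} = {(j, ?\<pi>' j) | j. j \<in> N'}" by auto
    then have ZZ: "?Z' = ?Z" by (simp add: cyclic_def)
    have "favourite P' A' ` ?Z = favourite P A' ` ?Z" "assign P' A' ?Z \<mu> = assign P A' ?Z \<mu>"
      using fav ZN by (auto simp: assign_def image_iff subset_iff)
    moreover have "ttc_after P N' A' \<mu> ?Z = ttc P' (N' - ?Z) (A' - favourite P A' ` ?Z) (assign P A' ?Z \<mu>)"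
      using iZ P by (intro ttc_cong wf_market_diff wf) auto
    ultimately show ?thesis using st ZZ by simp
  qed
qed

lemma fpttc_nonbossy:
  assumes "\<And>j. j \<in> {1..n} \<Longrightarrow> P j \<in> strict_orders (insert a0 A)" "q \<in> strict_orders (insert a0 A)"
    and "fpttc n A a0 prio P i = fpttc n A a0 prio (P(i := q)) i"
  shows "fpttc n A a0 prio P = fpttc n A a0 prio (P(i := q))"
  using assms ttc_nonbossy[of P "{1..n}" A "P(i := q)" i "restrict (\<lambda>_. a0) {1..n}"]
  by (simp add: fpttc_def ttc_def wf_market_def)

end

section \<open>Contracting irrelevant moves\<close>

lemma profiles_nonempty_iff: "profiles n D \<noteq> {} \<longleftrightarrow> (\<forall>i\<in>{1..n}. D i \<noteq> {})"
  by (auto simp: profiles_def PiE_eq_empty_iff)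

lemma profiles_upd:
  assumes "P \<in> profiles n D" "i \<in> {1..n}" "q \<in> K"
  shows "P(i := q) \<in> profiles n (D(i := K))"
  using assms by (auto simp: profiles_def PiE_iff extensional_def)

lemma profiles_mono: "(\<And>j. j \<in> {1..n} \<Longrightarrow> D j \<subseteq> D' j) \<Longrightarrow> profiles n D \<subseteq> profiles n D'"
  unfolding profiles_def by (rule PiE_mono)

lemma profilesD: "P \<in> profiles n D \<Longrightarrow> i \<in> {1..n} \<Longrightarrow> P i \<in> D i"
  by (auto simp: profiles_def)

definition is_split :: "'a pref set \<Rightarrow> 'a pref set set \<Rightarrow> bool" where
  "is_split D KK \<longleftrightarrow> finite KK \<and> \<Union>KK = D \<and> {} \<notin> KK \<and> disjoint KK"

text \<open>The reference type \<open>p\<close> need not be the type of \<open>i\<close> in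
  \<open>Q\<close>; it only has to lie in the same class. This freedom is what distinguishes SOSP
  from OSP.\<close>

definition sosp_choice ::
    "nat \<Rightarrow> ('a profile \<Rightarrow> 'a alloc) \<Rightarrow> (nat \<Rightarrow> 'a pref set) \<Rightarrow> nat \<Rightarrow> 'a pref set set \<Rightarrow> bool" where
  "sosp_choice n f D i KK \<longleftrightarrow> (\<forall>K\<in>KK. \<forall>L\<in>KK. K \<noteq> L \<longrightarrow>
     (\<forall>p\<in>K. \<forall>Q\<in>profiles n (D(i := K)). \<forall>R\<in>profiles n (D(i := L)). (f Q i, f R i) \<in> p\<^sup>=))"

lemma sosp_choiceD:
  "sosp_choice n f D i KK \<Longrightarrow> K \<in> KK \<Longrightarrow> L \<in> KK \<Longrightarrow> K \<noteq> L \<Longrightarrow> p \<in> K \<Longrightarrow>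
    Q \<in> profiles n (D(i := K)) \<Longrightarrow> R \<in> profiles n (D(i := L)) \<Longrightarrow> (f Q i, f R i) \<in> p\<^sup>="
  unfolding sosp_choice_def by blast

text \<open>\<open>D\<close> is the box of preferences that are not yet ruled out.\<close>

inductive sosp_game :: "nat \<Rightarrow> 'a alloc set \<Rightarrow> ('a profile \<Rightarrow> 'a alloc) \<Rightarrow> (nat \<Rightarrow> 'a pref set) \<Rightarrow> bool"
  for n M f where
  leaf: "\<mu> \<in> M \<Longrightarrow> (\<And>P. P \<in> profiles n D \<Longrightarrow> f P = \<mu>) \<Longrightarrow> sosp_game n M f D"
| node: "i \<in> {1..n} \<Longrightarrow> is_split (D i) KK \<Longrightarrow> KK \<noteq> {} \<Longrightarrow>
    sosp_choice n f D i KK \<Longrightarrow>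
    (\<And>K. K \<in> KK \<Longrightarrow> sosp_game n M f (D(i := K))) \<Longrightarrow> sosp_game n M f D"

text \<open>The children form a list so that a node can be addressed by the indices of the children
  leading to it.\<close>

datatype 'a game_tree = Leaf "'a alloc" | Branch nat "('a pref set \<times> 'a game_tree) list"

text \<open>\<open>S\<close> is the set of agents who have not moved yet.\<close>

inductive simple_game ::
    "nat \<Rightarrow> 'a alloc set \<Rightarrow> ('a profile \<Rightarrow> 'a alloc) \<Rightarrow> (nat \<Rightarrow> 'a pref set) \<Rightarrow> nat set \<Rightarrow>
      'a game_tree \<Rightarrow> bool"
  for n M f where
  leaf: "\<mu> \<in> M \<Longrightarrow> (\<And>P. P \<in> profiles n D \<Longrightarrow> f P = \<mu>) \<Longrightarrow> simple_game n M f D S (Leaf \<mu>)"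
| branch: "i \<in> {1..n} \<Longrightarrow> i \<in> S \<Longrightarrow> ks \<noteq> [] \<Longrightarrow> distinct (map fst ks) \<Longrightarrow>
    is_split (D i) (fst ` set ks) \<Longrightarrow>
    (\<And>K L P R. K \<in> fst ` set ks \<Longrightarrow> L \<in> fst ` set ks \<Longrightarrow> K \<noteq> L \<Longrightarrow> P \<in> profiles n (D(i := K)) \<Longrightarrow>
       R \<in> profiles n (D(i := L)) \<Longrightarrow> (f P i, f R i) \<in> (P i)\<^sup>=) \<Longrightarrow>
    (\<And>K t. (K, t) \<in> set ks \<Longrightarrow> simple_game n M f (D(i := K)) (S - {i}) t) \<Longrightarrow>
    simple_game n M f D S (Branch i ks)"

lemma simple_game_mono:
  "simple_game n M f D S t \<Longrightarrow> S \<subseteq> S' \<Longrightarrow> simple_game n M f D S' t"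
proof (induction arbitrary: S' rule: simple_game.induct)
  case (leaf \<mu> D S)
  then show ?case by (simp add: simple_game.leaf)
next
  case (branch i S ks D)
  show ?case
  proof (rule simple_game.branch)
    show "simple_game n M f (D(i := K)) (S' - {i}) t" if "(K, t) \<in> set ks" for K t
      using branch.IH[OF that] branch.prems by blast
  qed (use branch.hyps branch.prems in blast)+
qed

text \<open>Contraction of a move of \<open>i\<close>. Giving \<open>i\<close> the type
  \<open>q\<close> carries each profile of \<open>D\<close> into \<open>D(i := K)\<close> without
  changing the outcome, and \<open>i\<close> does not move in \<open>t\<close>. So the leaves and
  comparisons of \<open>t\<close> stay valid on all of \<open>D\<close>.\<close>

lemma simple_game_ignore:
  assumes "simple_game n M f D' S t" "D' = D(i := K)" "i \<in> {1..n}" "i \<notin> S" "q \<in> K"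
    and "\<And>P. P \<in> profiles n D \<Longrightarrow> f (P(i := q)) = f P"
  shows "simple_game n M f D S t"
  using assms
proof (induction arbitrary: D rule: simple_game.induct)
  case (leaf \<mu> D' S)
  show ?case
  proof (rule simple_game.leaf[OF leaf.hyps(1)])
    fix P assume P: "P \<in> profiles n D"
    then have "P(i := q) \<in> profiles n D'" using leaf.prems profiles_upd by metis
    then show "f P = \<mu>" using leaf.hyps(2) leaf.prems(5) P by metis
  qed
next
  case (branch j S ks D')
  have ij: "i \<noteq> j" using branch.hyps branch.prems by blast
  have sub: "profiles n (D(j := L)) \<subseteq> profiles n D" if "L \<in> fst ` set ks" for L
    using branch.hyps(5) branch.prems(1) ij that by (intro profiles_mono) (auto simp: is_split_def)
  have upd: "P(i := q) \<in> profiles n (D'(j := L))" if "P \<in> profiles n (D(j := L))" for P L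
    unfolding branch.prems(1) fun_upd_twist[OF ij] by (rule profiles_upd[OF that branch.prems(2,4)])
  show ?case
  proof (rule simple_game.branch)
    show "is_split (D j) (fst ` set ks)" using branch.hyps(5) branch.prems(1) ij by simp
    show "(f P j, f R j) \<in> (P j)\<^sup>="
      if "K' \<in> fst ` set ks" "L \<in> fst ` set ks" "K' \<noteq> L"
        "P \<in> profiles n (D(j := K'))" "R \<in> profiles n (D(j := L))" for K' L P R
      \<comment> \<open>The comparison is made at the updated profiles, where the type of
        \<open>j\<close> and both outcomes are unchanged.\<close>
      using branch.hyps(6)[OF that(1-3) upd[OF that(4)] upd[OF that(5)]] ij
        branch.prems(5) sub[OF that(1)] sub[OF that(2)] that(4,5) by (metis fun_upd_other subsetD)
    show "simple_game n M f (D(j := L)) (S - {j}) t" if "(L, t) \<in> set ks" for L t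
    proof (rule branch.IH[OF that])
      show "D'(j := L) = (D(j := L))(i := K)"
        unfolding branch.prems(1) by (rule fun_upd_twist[OF ij])
      show "f (P(i := q)) = f P" if "P \<in> profiles n (D(j := L))" for P
      proof -
        have "L \<in> fst ` set ks" using \<open>(L, t) \<in> set ks\<close> by force
        then show ?thesis using branch.prems(5) sub that by blast
      qed
    qed (use branch.prems in auto)
  qed (use branch.hyps in blast)+
qed

section \<open>Rich domains\<close>

definition lift_top :: "'a set \<Rightarrow> 'a \<Rightarrow> 'a pref \<Rightarrow> 'a pref" where
  "lift_top B x P = {(u, v) \<in> P. u \<noteq> x \<and> v \<noteq> x} \<union> {x} \<times> (B - {x})"

lemma lift_top_strict_order:
  assumes "P \<in> strict_orders B" "x \<in> B"
  shows "lift_top B x P \<in> strict_orders B"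
proof -
  note P = strict_ordersD[OF assms(1)]
  have "trans (lift_top B x P)"
    by (rule transI) (use P(1,4) in \<open>auto simp: lift_top_def\<close>)
  moreover have "irrefl (lift_top B x P)" using P(3) by (auto simp: irrefl_def lift_top_def)
  moreover have "total_on B (lift_top B x P)" using P(5) assms(2) by (auto simp: total_on_def lift_top_def)
  moreover have "lift_top B x P \<subseteq> B \<times> B" using P(1) assms(2) by (auto simp: lift_top_def)
  ultimately show ?thesis by (simp add: strict_orders_def strict_linear_order_on_def)
qed

text \<open>The pair \<open>(x, y) \<in> Q\<close> excludes \<open>x = a0\<close> if \<open>a0\<close> is the last element of every order.\<close>

definition rich_domain :: "'a set \<Rightarrow> 'a pref set \<Rightarrow> bool" where
  "rich_domain B F \<longleftrightarrow> F \<subseteq> strict_orders B \<and>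
     (\<forall>P\<in>F. \<forall>Q\<in>F. \<forall>(x, y)\<in>Q. lift_top B x P \<in> F)"

lemma rich_domain_strict_orders: "rich_domain B (strict_orders B)"
  using lift_top_strict_order strict_ordersD(1) unfolding rich_domain_def by fast

lemma rich_domain_all_acceptable:
  assumes "a0 \<notin> A"
  shows "rich_domain (insert a0 A) (all_acceptable_orders A a0)"
  unfolding rich_domain_def
proof (intro conjI ballI, safe)
  fix P Q x y assume P: "P \<in> all_acceptable_orders A a0" and Q: "Q \<in> all_acceptable_orders A a0"
    and xy: "(x, y) \<in> Q"
  have Qs: "Q \<in> strict_orders (insert a0 A)" using Q by (simp add: all_acceptable_orders_def)
  note Q' = strict_ordersD[OF Qs]
  have "x \<noteq> a0" using Q xy Q'(1,2,3) unfolding all_acceptable_orders_def by blast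
  then show "lift_top (insert a0 A) x P \<in> all_acceptable_orders A a0"
    using P xy Q'(1) lift_top_strict_order[of P "insert a0 A" x]
    by (auto simp: all_acceptable_orders_def lift_top_def)
qed (simp add: all_acceptable_orders_def)

section \<open>Agents whose remaining types agree\<close>

text \<open>The invariant for agents who are not allowed to move any more. Only assignments still
  attainable are compared, so it passes to every smaller box.\<close>

definition spent :: "nat \<Rightarrow> ('a profile \<Rightarrow> 'a alloc) \<Rightarrow> (nat \<Rightarrow> 'a pref set) \<Rightarrow> nat \<Rightarrow> bool" where
  "spent n f D i \<longleftrightarrow> (\<forall>P\<in>profiles n D. \<forall>P'\<in>profiles n D. \<forall>p\<in>D i. \<forall>q\<in>D i.
     (f P i, f P' i) \<in> p \<longrightarrow> (f P i, f P' i) \<in> q)"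

lemma spent_mono:
  assumes "spent n f D j" "\<And>i. D' i \<subseteq> D i"
  shows "spent n f D' j"
proof -
  have "profiles n D' \<subseteq> profiles n D" using assms(2) by (rule profiles_mono)
  then show ?thesis using assms unfolding spent_def by (meson subsetD)
qed

text \<open>If two types in \<open>K\<close> disagreed on \<open>x\<close> and \<open>y\<close>, then a type ranking \<open>x > z > y\<close> on top, with
  \<open>z\<close> an outcome of another choice \<open>L\<close>, could belong to no choice at all.\<close>

lemma spent_after_split:
  assumes rich: "rich_domain B (D i)" and i: "i \<in> {1..n}" and KK: "is_split (D i) KK"
    and choice: "sosp_choice n f D i KK"
    and ne: "\<And>j. j \<in> {1..n} \<Longrightarrow> D j \<noteq> {}"
    and K: "K \<in> KK" and L: "L \<in> KK" "K \<noteq> L"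
  shows "spent n f (D(i := K)) i"
  unfolding spent_def
proof (intro ballI impI, rule ccontr)
  fix P P' p q
  assume P: "P \<in> profiles n (D(i := K))" "P' \<in> profiles n (D(i := K))"
    and p: "p \<in> (D(i := K)) i" "q \<in> (D(i := K)) i"
    and disagree: "(f P i, f P' i) \<in> p" "(f P i, f P' i) \<notin> q"
  note sosp = sosp_choiceD[OF choice]
  define x y where "x = f P i" and "y = f P' i"
  have sub: "M \<subseteq> D i" if "M \<in> KK" for M using KK that by (auto simp: is_split_def)
  have so: "r \<in> strict_orders B" if "r \<in> D i" for r using rich that by (auto simp: rich_domain_def)
  have pD: "p \<in> D i" "q \<in> D i" using p sub K by auto
  note po = strict_ordersD[OF so[OF pD(1)]] and qo = strict_ordersD[OF so[OF pD(2)]]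
  have box: "\<exists>R. R \<in> profiles n (D(i := M))" if "M \<in> KK" for M
  proof -
    have "M \<noteq> {}" using KK that by (auto simp: is_split_def)
    then have "profiles n (D(i := M)) \<noteq> {}" using ne by (auto simp: profiles_nonempty_iff)
    then show ?thesis by blast
  qed
  obtain R where R: "R \<in> profiles n (D(i := L))" using box L by blast
  define z where "z = f R i"
  have RL: "R i \<in> L" using profilesD[OF R i] by simp
  then have RD: "R i \<in> D i" using sub L by blast
  note ro = strict_ordersD[OF so[OF RD]]
  have xy: "(x, y) \<in> p" "x \<noteq> y" "x \<in> B" "y \<in> B"
    using disagree po(1,3) by (auto simp: x_def y_def)
  then have yx: "(y, x) \<in> q" using disagree qo(5) by (auto simp: x_def y_def)
  \<comment> \<open>\<open>z\<close> is what \<open>i\<close> gets after the choice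
    \<open>L\<close>. So \<open>p\<close> ranks \<open>x\<close> above \<open>y\<close> and
    \<open>y\<close> weakly above \<open>z\<close>, whereas \<open>q\<close> ranks \<open>y\<close>
    above \<open>x\<close> and \<open>x\<close> weakly above \<open>z\<close>; hence
    \<open>z\<close> differs from both.\<close>
  have z: "(y, z) \<in> p\<^sup>=" "(x, z) \<in> q\<^sup>=" "(z, x) \<in> (R i)\<^sup>="
    using sosp[OF K L] sosp[OF L(1) K L(2)[symmetric]] P R RL p
    by (auto simp: x_def y_def z_def)
  have zx: "z \<noteq> x" using z(1) xy po(2) by auto
  have zy: "z \<noteq> y" using z(2) yx xy qo(2) by auto
  have zxR: "(z, x) \<in> R i" using z(3) zx by auto
  have zB: "z \<in> B" using zxR ro(1) by auto
  \<comment> \<open>\<open>r\<close> ranks \<open>x\<close>, then \<open>z\<close>, then the rest as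
    in \<open>p\<close>. Richness applies twice: \<open>z\<close> is above \<open>x\<close> in
    \<open>R i\<close>, and \<open>x\<close> is above \<open>y\<close> in \<open>p\<close>.\<close>
  define r where "r = lift_top B x (lift_top B z p)"
  have "lift_top B z p \<in> D i" using rich pD RD zxR unfolding rich_domain_def by fast
  then have "r \<in> D i" using rich pD xy(1) unfolding rich_domain_def r_def by fast
  note ror = strict_ordersD[OF so[OF this]]
  obtain M where M: "M \<in> KK" "r \<in> M" using \<open>r \<in> D i\<close> KK by (auto simp: is_split_def)
  have rxy: "(x, y) \<in> r" "(x, z) \<in> r" "(z, y) \<in> r"
    using xy zx zy zB by (auto simp: r_def lift_top_def)
  have top: "u = x" if "(u, x) \<in> r\<^sup>=" for u using that by (auto simp: r_def lift_top_def)
  \<comment> \<open>If \<open>r\<close> is in \<open>K\<close>, SOSP puts \<open>y\<close> weakly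
    above \<open>z\<close> in \<open>r\<close>. If \<open>r\<close> is in another class, that class
    can yield only \<open>x\<close>, the top of \<open>r\<close>, since \<open>K\<close> can yield
    \<open>x\<close>; but then \<open>p\<close> in \<open>K\<close> would rank \<open>y\<close>
    weakly above \<open>x\<close>.\<close>
  show False
  proof (cases "M = K")
    case True
    then have "(y, z) \<in> r\<^sup>=" using sosp[OF K L _ P(2) R] M by (simp add: y_def z_def)
    then show False using rxy(3) ror(2) zy by blast
  next
    case False
    obtain T where T: "T \<in> profiles n (D(i := M))" using box M by blast
    have "(f T i, x) \<in> r\<^sup>=" using sosp[OF M(1) K False M(2) T P(1)] by (simp add: x_def)
    then have "f T i = x" using top by blast
    moreover have "(y, f T i) \<in> p\<^sup>=" using sosp[OF K M(1) _ _ P(2) T] False p by (simp add: y_def)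
    ultimately show False using xy po(2) by auto
  qed
qed

text \<open>Each choice set of a spent player weakly dominates every other one according to a common
  ranking, so that they all consist of the same single outcome.\<close>

lemma spent_split_constant:
  assumes spent: "spent n f D i" and so: "D i \<subseteq> strict_orders B" and i: "i \<in> {1..n}"
    and KK: "is_split (D i) KK"
    and choice: "sosp_choice n f D i KK"
    and KL: "K \<in> KK" "L \<in> KK" "K \<noteq> L"
    and P: "P \<in> profiles n D" "P' \<in> profiles n D"
  shows "f P i = f P' i"
proof -
  note sosp = sosp_choiceD[OF choice]
  have in_class: "\<exists>M\<in>KK. P i \<in> M \<and> P \<in> profiles n (D(i := M))" if "P \<in> profiles n D" for P
  proof -
    have "P i \<in> \<Union>KK" using profilesD[OF that i] KK by (simp add: is_split_def)
    then show ?thesis using profiles_upd[OF that i] fun_upd_triv by (metis UnionE)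
  qed
  have cross: "f Q i = f R i"
    if M: "M \<in> KK" "M' \<in> KK" "M \<noteq> M'" and Q: "Q \<in> profiles n (D(i := M))"
      and R: "R \<in> profiles n (D(i := M'))" for M M' Q R
  proof -
    have Qi: "Q i \<in> M" "R i \<in> M'" using profilesD[OF Q i] profilesD[OF R i] by auto
    then have QD: "Q i \<in> D i" "R i \<in> D i" using M KK by (auto simp: is_split_def)
    have sub: "profiles n (D(i := M'')) \<subseteq> profiles n D" if "M'' \<in> KK" for M''
      using KK that by (intro profiles_mono) (auto simp: is_split_def)
    have QR: "Q \<in> profiles n D" "R \<in> profiles n D" using sub M Q R by blast+
    have 1: "(f Q i, f R i) \<in> (Q i)\<^sup>=" using sosp[OF M Qi(1) Q R] .
    have "(f R i, f Q i) \<in> (R i)\<^sup>=" using sosp[OF M(2,1) M(3)[symmetric] Qi(2) R Q] .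
    then have 2: "(f R i, f Q i) \<in> (Q i)\<^sup>=" using spent QR QD unfolding spent_def by blast
    have "Q i \<in> strict_orders B" using so QD by blast
    then show ?thesis using 1 2 strict_ordersD(2)[of "Q i" B] by auto
  qed
  obtain M M' where M: "M \<in> KK" "P \<in> profiles n (D(i := M))" and M': "M' \<in> KK" "P' \<in> profiles n (D(i := M'))"
    using in_class P by blast
  show ?thesis
  proof (cases "M = M'")
    case False
    then show ?thesis using cross M M' by blast
  next
    case True
    \<comment> \<open>SOSP compares nothing within one class, so both outcomes are compared with
      that of \<open>P(i := q)\<close>, which lies in another class.\<close>
    obtain N where N: "N \<in> KK" "N \<noteq> M" using KL by metis
    then obtain q where q: "q \<in> N" using KK unfolding is_split_def by (metis all_not_in_conv)
    have "P(i := q) \<in> profiles n (D(i := N))" using profiles_upd[OF P(1) i q] .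
    then show ?thesis using cross[OF M(1) N(1) _ M(2)] cross[OF M'(1) N(1) _ M'(2)] N True by metis
  qed
qed

text \<open>Vacuous: with one attainable assignment, the premise in \<open>spent\<close> would be a
  reflexive pair of a strict order.\<close>

lemma constant_imp_spent:
  assumes "\<And>P P'. P \<in> profiles n D \<Longrightarrow> P' \<in> profiles n D \<Longrightarrow> f P i = f P' i" "D i \<subseteq> strict_orders B"
  shows "spent n f D i"
  unfolding spent_def using assms strict_ordersD(3) by (metis subsetD)

section \<open>From SOSP games to simple games\<close>

text \<open>Agents in \<open>S\<close> still have the full factor \<open>F\<close>, so richness is
  available for them; all others are spent. A node is kept as a branch only if it has at least two
  classes and the mover's assignment varies over the box.\<close>

lemma sosp_game_imp_simple_game:
  assumes "sosp_game n M f D" and rich: "rich_domain B F"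
    and nonbossy: "\<And>P i q. (\<And>j. j \<in> {1..n} \<Longrightarrow> P j \<in> F) \<Longrightarrow> i \<in> {1..n} \<Longrightarrow> q \<in> F \<Longrightarrow>
        f P i = f (P(i := q)) i \<Longrightarrow> f P = f (P(i := q))"
    and "\<And>j. j \<in> {1..n} \<Longrightarrow> D j \<noteq> {} \<and> D j \<subseteq> F" "S \<subseteq> {1..n}"
    and "\<And>j. j \<in> S \<Longrightarrow> D j = F" "\<And>j. j \<in> {1..n} - S \<Longrightarrow> spent n f D j"
  shows "\<exists>t. simple_game n M f D S t"
  using assms(1,4-)
proof (induction arbitrary: S rule: sosp_game.induct)
  case (leaf \<mu> D)
  then show ?case using simple_game.leaf by meson
next
  case (node i D KK)
  note i = node.hyps(1) and KK = node.hyps(2,3) and choice = node.hyps(4)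
    and D = node.prems(1) and S = node.prems(2) and fresh = node.prems(3) and sp = node.prems(4)
  have so: "D i \<subseteq> strict_orders B" using D[OF i] rich by (auto simp: rich_domain_def)
  have sub: "(D(i := K)) j \<subseteq> D j" if "K \<in> KK" for K j using KK that by (auto simp: is_split_def)
  have D': "(D(i := K)) j \<noteq> {} \<and> (D(i := K)) j \<subseteq> F" if "K \<in> KK" "j \<in> {1..n}" for K j
    using D[OF that(2)] sub[OF that(1), of j] KK that by (auto simp: is_split_def)
  have IH: "\<exists>t. simple_game n M f (D(i := K)) (S - {i}) t" if "K \<in> KK" "spent n f (D(i := K)) i" for K
  proof (rule node.IH[OF that(1)])
    show "spent n f (D(i := K)) j" if "j \<in> {1..n} - (S - {i})" for j
    proof (cases "j = i")
      case False
      then show ?thesis using that by (intro spent_mono[OF sp sub[OF \<open>K \<in> KK\<close>]]) auto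
    qed (use \<open>spent n f (D(i := K)) i\<close> in simp)
  qed (use S fresh D'[OF that(1)] in auto)
  consider (single) K where "KK = {K}"
    | (const) "\<And>P P'. P \<in> profiles n D \<Longrightarrow> P' \<in> profiles n D \<Longrightarrow> f P i = f P' i"
    | (split) "\<And>K. K \<in> KK \<Longrightarrow> \<exists>L\<in>KK. K \<noteq> L" "\<exists>P\<in>profiles n D. \<exists>P'\<in>profiles n D. f P i \<noteq> f P' i"
    using KK(2) by (metis is_singletonI' is_singleton_def)
  then show ?case
  proof cases
    case single
    \<comment> \<open>A single class reveals nothing: the node is dropped and \<open>i\<close> may
      stay in \<open>S\<close>.\<close>
    then have "D(i := K) = D" using KK by (auto simp: is_split_def)
    then show ?thesis using node.IH[of K S] node.prems single by simp
  next
    case const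
    obtain K where K: "K \<in> KK" using KK by blast
    obtain q where q: "q \<in> K" using K KK unfolding is_split_def by (metis all_not_in_conv)
    have qF: "q \<in> F" "q \<in> D i" using D[OF i] q K KK by (auto simp: is_split_def)
    \<comment> \<open>The factor of \<open>i\<close> is about to shrink to \<open>K\<close>, so
      \<open>i\<close> has to leave \<open>S\<close> although she gets no branch.\<close>
    have "spent n f D i" using const so by (intro constant_imp_spent)
    then have "spent n f (D(i := K)) i" by (rule spent_mono) (rule sub[OF K])
    then obtain t where t: "simple_game n M f (D(i := K)) (S - {i}) t" using IH K by blast
    have "simple_game n M f D (S - {i}) t"
    proof (rule simple_game_ignore[OF t refl i _ q])
      fix P assume P: "P \<in> profiles n D"
      have "P(i := q) \<in> profiles n D" using profiles_upd[OF P i qF(2)] by simp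
      then have "f P i = f (P(i := q)) i" using const P by blast
      moreover have "P j \<in> F" if "j \<in> {1..n}" for j using D[OF that] profilesD[OF P that] by blast
      ultimately show "f (P(i := q)) = f P" using nonbossy i qF by metis
    qed simp
    then show ?thesis using simple_game_mono by blast
  next
    case split
    obtain K L where KL: "K \<in> KK" "L \<in> KK" "K \<noteq> L" using split(1) KK(2) by blast
    \<comment> \<open>A spent agent facing two classes has a constant assignment, which this case
      excludes.\<close>
    have iS: "i \<in> S"
    proof (rule ccontr)
      assume "i \<notin> S"
      then have "spent n f D i" using sp i by blast
      then show False using spent_split_constant[OF _ so i KK(1) choice KL] split(2) by blast
    qed
    have richD: "rich_domain B (D i)" using rich fresh[OF iS] by simp
    have "\<exists>t. simple_game n M f (D(i := K)) (S - {i}) t" if "K \<in> KK" for K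
    proof (rule IH[OF that])
      obtain L where "L \<in> KK" "K \<noteq> L" using split(1)[OF \<open>K \<in> KK\<close>] by blast
      then show "spent n f (D(i := K)) i"
        using spent_after_split[OF richD i KK(1) choice _ that] D by blast
    qed
    then obtain t where t: "simple_game n M f (D(i := K)) (S - {i}) (t K)" if "K \<in> KK" for K by metis
    obtain Ks where Ks: "set Ks = KK" "distinct Ks" using KK finite_distinct_list unfolding is_split_def by metis
    define ks where "ks = map (\<lambda>K. (K, t K)) Ks"
    have fst: "fst ` set ks = KK" using Ks by (auto simp: ks_def image_image)
    have "simple_game n M f D S (Branch i ks)"
    proof (rule simple_game.branch[OF i iS])
      show "ks \<noteq> []" using Ks KK by (auto simp: ks_def)
      show "distinct (map fst ks)" using Ks by (simp add: ks_def comp_def)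
      show "is_split (D i) (fst ` set ks)" using fst KK by simp
      show "simple_game n M f (D(i := K)) (S - {i}) t'" if "(K, t') \<in> set ks" for K t'
        using that t Ks by (auto simp: ks_def)
      show "(f P i, f R i) \<in> (P i)\<^sup>="
        if "K \<in> fst ` set ks" "L \<in> fst ` set ks" "K \<noteq> L" "P \<in> profiles n (D(i := K))"
          "R \<in> profiles n (D(i := L))" for K L P R
        \<comment> \<open>OSP is the instance of SOSP in which the reference type is the true type
          \<open>P i\<close>.\<close>
        using sosp_choiceD[OF choice, of K L "P i" P R] that profilesD[OF that(4) i] fst by simp
    qed
    then show ?thesis by blast
  qed
qed

section \<open>Plays of a mechanism\<close>

text \<open>\<open>is_mechanism\<close> refers only to the last move of an agent. Intersecting all
  her labels along the path avoids singling it out; \<open>union_out_edges\<close> shows that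
  nothing is lost.\<close>

definition consistent ::
    "('v, 'a) mechanism \<Rightarrow> (nat \<Rightarrow> 'a pref set) \<Rightarrow> 'v list \<Rightarrow> nat \<Rightarrow> 'a pref set" where
  "consistent G Ps vs j = {p \<in> Ps j. \<forall>k. Suc k < length vs \<and> mover G (vs ! k) = j \<longrightarrow>
     p \<in> edge_prefs G (vs ! k, vs ! Suc k)}"

lemma consistent_single: "consistent G Ps [v] = Ps"
  by (auto simp: consistent_def)

lemma consistent_snoc:
  assumes "vs \<noteq> []"
  shows "consistent G Ps (vs @ [w]) = (consistent G Ps vs)
    (mover G (last vs) := consistent G Ps vs (mover G (last vs)) \<inter> edge_prefs G (last vs, w))"
proof
  fix j
  have *: "Suc k < length (vs @ [w]) \<longleftrightarrow> Suc k < length vs \<or> k = length vs - 1" for k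
    using assms by (cases vs) auto
  have "(vs @ [w]) ! (length vs - 1) = last vs" "(vs @ [w]) ! Suc (length vs - 1) = w"
    using assms by (auto simp: nth_append last_conv_nth)
  moreover have "(vs @ [w]) ! k = vs ! k" "(vs @ [w]) ! Suc k = vs ! Suc k" if "Suc k < length vs" for k
    using that by (auto simp: nth_append)
  ultimately have "p \<in> consistent G Ps (vs @ [w]) j \<longleftrightarrow> p \<in> consistent G Ps vs j \<and>
      (mover G (last vs) = j \<longrightarrow> p \<in> edge_prefs G (last vs, w))" for p
    unfolding consistent_def mem_Collect_eq * by metis
  then show "consistent G Ps (vs @ [w]) j = ((consistent G Ps vs)
    (mover G (last vs) := consistent G Ps vs (mover G (last vs)) \<inter> edge_prefs G (last vs, w))) j"
    by auto
qed

lemma profiles_consistent_iff: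
  "P \<in> profiles n (consistent G Ps vs) \<longleftrightarrow> P \<in> profiles n Ps \<and>
    (\<forall>k. Suc k < length vs \<and> mover G (vs ! k) \<in> {1..n} \<longrightarrow>
      P (mover G (vs ! k)) \<in> edge_prefs G (vs ! k, vs ! Suc k))"
  unfolding profiles_def PiE_iff consistent_def by blast

lemma is_path_edge: "is_path G vs \<Longrightarrow> Suc k < length vs \<Longrightarrow> (vs ! k, vs ! Suc k) \<in> edges G"
  unfolding is_path_def by (simp add: successively_conv_nth)

lemma is_path_take:
  assumes "is_path G vs"
  shows "is_path G (take (Suc k) vs)"
proof -
  have "successively (\<lambda>u v. (u, v) \<in> edges G) (take (Suc k) vs @ drop (Suc k) vs)"
    using assms by (simp add: is_path_def)
  then have "successively (\<lambda>u v. (u, v) \<in> edges G) (take (Suc k) vs)"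
    unfolding successively_append_iff by blast
  then show ?thesis using assms set_take_subset[of "Suc k" vs] by (auto simp: is_path_def)
qed

lemma root_path_take:
  assumes "is_path G vs" "hd vs = root_node G" "k < length vs"
  shows "root_path G (vs ! k) (take (Suc k) vs)"
proof -
  have "hd (take (Suc k) vs) = hd vs" by (simp add: hd_take)
  moreover have "last (take (Suc k) vs) = vs ! k"
    using assms(3) by (simp add: take_Suc_conv_app_nth)
  ultimately show ?thesis using is_path_take[OF assms(1)] assms(2) by (simp add: root_path_def)
qed

section \<open>Paths and plays in a fixed mechanism\<close>

locale game =
  fixes n :: nat and A :: "'a set" and a0 :: 'a and Ps :: "nat \<Rightarrow> 'a pref set"
    and G :: "('v, 'a) mechanism"
  assumes mech: "is_mechanism n A a0 Ps G"
begin

lemmas mech' = mech[unfolded is_mechanism_def]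

lemma
  shows tree: "is_rooted_tree G"
    and leaf_alloc_in: "v \<in> leaves G \<Longrightarrow> leaf_alloc G v \<in> allocations n A a0"
    and mover_in: "v \<in> inner_nodes G \<Longrightarrow> mover G v \<in> {1..n}"
    and edge_prefs_ne: "e \<in> edges G \<Longrightarrow> edge_prefs G e \<noteq> {}"
    and edge_prefs_disj: "e \<in> edges G \<Longrightarrow> e' \<in> edges G \<Longrightarrow> fst e = fst e' \<Longrightarrow> e \<noteq> e' \<Longrightarrow>
       edge_prefs G e \<inter> edge_prefs G e' = {}"
    and prefs_last_move: "v \<in> inner_nodes G \<Longrightarrow> root_path G v vs \<Longrightarrow> last_move G vs k \<Longrightarrow>
       (\<Union>e\<in>out_edges G v. edge_prefs G e) = edge_prefs G (vs ! k, vs ! Suc k)"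
    and prefs_first_move: "v \<in> inner_nodes G \<Longrightarrow> root_path G v vs \<Longrightarrow> \<nexists>k. last_move G vs k \<Longrightarrow>
       (\<Union>e\<in>out_edges G v. edge_prefs G e) = Ps (mover G v)"
proof -
  note m1 = mech'[THEN conjunct2] and m2 = mech'[THEN conjunct2, THEN conjunct2]
  note m3 = m2[THEN conjunct2] and m4 = m2[THEN conjunct2, THEN conjunct2]
  note m5 = m4[THEN conjunct2]
  show "is_rooted_tree G" by (rule mech'[THEN conjunct1])
  show "v \<in> leaves G \<Longrightarrow> leaf_alloc G v \<in> allocations n A a0"
    by (rule m1[THEN conjunct1, rule_format])
  show "v \<in> inner_nodes G \<Longrightarrow> mover G v \<in> {1..n}" by (rule m2[THEN conjunct1, rule_format])
  show "e \<in> edges G \<Longrightarrow> edge_prefs G e \<noteq> {}"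
    by (rule m3[THEN conjunct1, THEN bspec, THEN conjunct1])
  show "e \<in> edges G \<Longrightarrow> e' \<in> edges G \<Longrightarrow> fst e = fst e' \<Longrightarrow> e \<noteq> e' \<Longrightarrow>
       edge_prefs G e \<inter> edge_prefs G e' = {}"
    by (rule m4[THEN conjunct1, rule_format]) simp_all
  show "v \<in> inner_nodes G \<Longrightarrow> root_path G v vs \<Longrightarrow> last_move G vs k \<Longrightarrow>
       (\<Union>e\<in>out_edges G v. edge_prefs G e) = edge_prefs G (vs ! k, vs ! Suc k)"
    by (rule m5[rule_format, THEN conjunct1, rule_format])
  show "v \<in> inner_nodes G \<Longrightarrow> root_path G v vs \<Longrightarrow> \<nexists>k. last_move G vs k \<Longrightarrow>
       (\<Union>e\<in>out_edges G v. edge_prefs G e) = Ps (mover G v)"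
    by (rule m5[rule_format, THEN conjunct2, THEN mp])
qed

lemma
  shows finite_nodes: "finite (nodes G)" and edges_sub: "edges G \<subseteq> nodes G \<times> nodes G"
    and root_in: "root_node G \<in> nodes G"
    and root_path_unique: "v \<in> nodes G \<Longrightarrow> root_path G v vs \<Longrightarrow> root_path G v ws \<Longrightarrow> vs = ws"
    and root_path_exists: "v \<in> nodes G \<Longrightarrow> \<exists>vs. root_path G v vs"
  using tree unfolding is_rooted_tree_def by blast+

lemma root_path_in: "root_path G v vs \<Longrightarrow> v \<in> nodes G"
  unfolding root_path_def is_path_def by (metis last_in_set subsetD)

lemma source_inner: "(v, w) \<in> edges G \<Longrightarrow> v \<in> inner_nodes G"
  using edges_sub by (auto simp: inner_nodes_def leaves_def out_edges_def)

lemma root_path_snoc: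
  assumes "root_path G v vs" "(v, w) \<in> edges G"
  shows "root_path G w (vs @ [w])"
  using assms edges_sub unfolding root_path_def is_path_def
  by (auto simp: successively_append_iff)

lemma root_path_root: "root_path G (root_node G) [root_node G]"
  using root_in by (simp add: root_path_def is_path_def)

lemma root_path_induct [consumes 1, case_names root snoc]:
  assumes "root_path G v vs" "Q (root_node G) [root_node G]"
    and "\<And>v w vs. root_path G v vs \<Longrightarrow> Q v vs \<Longrightarrow> (v, w) \<in> edges G \<Longrightarrow> Q w (vs @ [w])"
  shows "Q v vs"
  using assms(1)
proof (induction vs arbitrary: v rule: rev_induct)
  case Nil
  then show ?case by (simp add: root_path_def is_path_def)
next
  case (snoc w vs)
  show ?case
  proof (cases "vs = []")
    case True
    then show ?thesis using snoc.prems assms(2) by (auto simp: root_path_def)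
  next
    case False
    have "root_path G (last vs) vs" "(last vs, w) \<in> edges G" "v = w"
      using snoc.prems False
      by (auto simp: root_path_def is_path_def successively_append_iff)
    then show ?thesis using assms(3) snoc.IH by metis
  qed
qed

text \<open>A repeated node would be reached by two different prefixes, both of them root paths.
  Distinctness bounds path lengths by the number of nodes, the measure for inductions towards the
  leaves.\<close>

lemma root_path_distinct: "root_path G v vs \<Longrightarrow> distinct vs"
  unfolding distinct_conv_nth
proof (intro allI impI notI)
  fix i j assume vs: "root_path G v vs" and ij: "i < length vs" "j < length vs" "i \<noteq> j" "vs ! i = vs ! j"
  have "root_path G (vs ! i) (take (Suc i) vs)" "root_path G (vs ! i) (take (Suc j) vs)"
    using root_path_take[of G vs i] root_path_take[of G vs j] vs ij by (auto simp: root_path_def)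
  then have "take (Suc i) vs = take (Suc j) vs" using root_path_unique root_path_in by blast
  then show False using ij by (metis Suc_inject Suc_leI length_take min.absorb2)
qed

lemma root_path_length:
  assumes "root_path G v vs"
  shows "length vs \<le> card (nodes G)"
proof -
  have "card (set vs) \<le> card (nodes G)"
    using assms finite_nodes by (intro card_mono) (auto simp: root_path_def is_path_def)
  then show ?thesis using root_path_distinct[OF assms] by (simp add: distinct_card)
qed

text \<open>The two claims depend on each other. The first one turns the label of the last move into
  the set of compatible types, which gives the second at the same node; the second makes the next
  label a subset of the compatible types, which gives the first for the longer path.\<close>

lemma union_out_edges_aux:
  assumes "root_path G v vs"
  shows "(\<forall>j k. Suc k < length vs \<and> mover G (vs ! k) = j \<and>
        (\<forall>s. k < s \<and> s < length vs - 1 \<longrightarrow> mover G (vs ! s) \<noteq> j) \<longrightarrow>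
        consistent G Ps vs j = edge_prefs G (vs ! k, vs ! Suc k)) \<and>
     (v \<in> inner_nodes G \<longrightarrow> (\<Union>e\<in>out_edges G v. edge_prefs G e) = consistent G Ps vs (mover G v))"
    (is "?A vs \<and> ?B v vs")
proof -
  have AB: "?B v vs" if "?A vs" and r: "root_path G v vs" for v vs
  proof
    assume v: "v \<in> inner_nodes G"
    have l: "last vs = v" using r by (simp add: root_path_def)
    show "(\<Union>e\<in>out_edges G v. edge_prefs G e) = consistent G Ps vs (mover G v)"
    proof (cases "\<exists>k. last_move G vs k")
      case True
      then obtain k where k: "last_move G vs k" by blast
      then have "consistent G Ps vs (mover G v) = edge_prefs G (vs ! k, vs ! Suc k)"
        using \<open>?A vs\<close>[rule_format, of k "mover G v"] l by (auto simp: last_move_def)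
      then show ?thesis using prefs_last_move[OF v r k] by simp
    next
      case False
      have "mover G (vs ! k) \<noteq> mover G v" if "Suc k < length vs" for k
      proof
        assume *: "mover G (vs ! k) = mover G v"
        \<comment> \<open>The last earlier move of this agent; maximality yields the final condition
          of \<open>last_move\<close>.\<close>
        define m where "m = (GREATEST k. Suc k < length vs \<and> mover G (vs ! k) = mover G v)"
        have "Suc m < length vs \<and> mover G (vs ! m) = mover G v"
          unfolding m_def by (rule GreatestI_nat[where b = "length vs"]) (use * that in auto)
        moreover have "k' \<le> m" if "Suc k' < length vs \<and> mover G (vs ! k') = mover G v" for k'
          unfolding m_def by (rule Greatest_le_nat[where b = "length vs"]) (use that in auto)
        then have "mover G (vs ! s) \<noteq> mover G v" if "m < s" "s < length vs - 1" for s
          using that by (metis add.commute less_diff_conv linorder_not_le plus_1_eq_Suc)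
        ultimately have "last_move G vs m" by (auto simp: last_move_def l)
        then show False using False by blast
      qed
      then have "consistent G Ps vs (mover G v) = Ps (mover G v)" by (auto simp: consistent_def)
      then show ?thesis using prefs_first_move[OF v r False] by simp
    qed
  qed
  have A: "?A vs" using assms
  proof (induction rule: root_path_induct)
    case (snoc v w vs)
    have vs: "vs \<noteq> []" "last vs = v" using snoc.hyps by (auto simp: root_path_def is_path_def)
    \<comment> \<open>As the new label lies inside the compatible types, intersecting with it leaves
      just the label.\<close>
    have e: "edge_prefs G (v, w) \<subseteq> consistent G Ps vs (mover G v)"
      using AB[OF snoc.IH snoc.hyps(1)] source_inner[OF snoc.hyps(2)] snoc.hyps(2)
      by (auto simp: out_edges_def)
    have c: "consistent G Ps (vs @ [w]) = (consistent G Ps vs)(mover G v := edge_prefs G (v, w))"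
      using consistent_snoc[OF vs(1), of G Ps w] vs(2) e by (simp add: Int_absorb1)
    show ?case
    proof (intro allI impI, elim conjE)
      fix j k assume k: "Suc k < length (vs @ [w])" "mover G ((vs @ [w]) ! k) = j"
        "\<forall>s. k < s \<and> s < length (vs @ [w]) - 1 \<longrightarrow> mover G ((vs @ [w]) ! s) \<noteq> j"
      show "consistent G Ps (vs @ [w]) j = edge_prefs G ((vs @ [w]) ! k, (vs @ [w]) ! Suc k)"
      proof (cases "Suc k = length vs")
        case True
        moreover from this have "length vs - Suc 0 = k" by simp
        ultimately have "(vs @ [w]) ! k = v" "(vs @ [w]) ! Suc k = w"
          using vs by (auto simp: nth_append last_conv_nth)
        then show ?thesis using c k(2) by simp
      next
        case False
        then have k': "Suc k < length vs" using k(1) by simp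
        have "(vs @ [w]) ! (length vs - 1) = v" using vs by (simp add: nth_append last_conv_nth)
        moreover have "k < length vs - 1 \<and> length vs - 1 < length (vs @ [w]) - 1" using k' by auto
        ultimately have "mover G v \<noteq> j" using k(3) by metis
        moreover have "mover G (vs ! s) \<noteq> j" if "k < s" "s < length vs - 1" for s
          using k(3)[rule_format, of s] that by (simp add: nth_append)
        then have "consistent G Ps vs j = edge_prefs G (vs ! k, vs ! Suc k)"
          using k' k(2) by (intro snoc.IH[rule_format]) (auto simp: nth_append)
        ultimately show ?thesis using c k' by (simp add: nth_append)
      qed
    qed
  qed simp
  show ?thesis by (rule conjI[OF A AB[OF A assms]])
qed

lemma union_out_edges:
  "root_path G v vs \<Longrightarrow> v \<in> inner_nodes G \<Longrightarrow>
    (\<Union>e\<in>out_edges G v. edge_prefs G e) = consistent G Ps vs (mover G v)"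
  by (rule union_out_edges_aux[THEN conjunct2, rule_format])

lemma consistent_child:
  assumes "root_path G v vs" "(v, w) \<in> edges G"
  shows "consistent G Ps (vs @ [w]) = (consistent G Ps vs)(mover G v := edge_prefs G (v, w))"
proof -
  have "edge_prefs G (v, w) \<subseteq> consistent G Ps vs (mover G v)"
    unfolding union_out_edges[OF assms(1) source_inner[OF assms(2)], symmetric]
    by (rule UN_upper) (use assms(2) in \<open>simp add: out_edges_def\<close>)
  then show ?thesis
    using consistent_snoc[of vs G Ps w] assms(1) by (simp add: root_path_def is_path_def Int_absorb1)
qed

text \<open>The labels at an inner node cover all compatible types of its mover, so the play can be
  continued until it reaches a leaf.\<close>

lemma play_extends:
  assumes "root_path G v vs" "P \<in> profiles n (consistent G Ps vs)"
  shows "\<exists>ws. is_play G P (vs @ ws)"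
  using assms
proof (induction "card (nodes G) - length vs" arbitrary: v vs rule: less_induct)
  case less
  note r = less.prems(1)
  show ?case
  proof (cases "v \<in> inner_nodes G")
    case True
    have "P (mover G v) \<in> consistent G Ps vs (mover G v)"
      using profilesD[OF less.prems(2) mover_in[OF True]] .
    then obtain w where w: "(v, w) \<in> edges G" "P (mover G v) \<in> edge_prefs G (v, w)"
      unfolding union_out_edges[OF r True, symmetric] by (auto simp: out_edges_def)
    have r': "root_path G w (vs @ [w])" using root_path_snoc[OF r w(1)] .
    have "P(mover G v := P (mover G v)) \<in> profiles n (consistent G Ps (vs @ [w]))"
      unfolding consistent_child[OF r w(1)] by (rule profiles_upd[OF less.prems(2) mover_in[OF True] w(2)])
    then have "\<exists>ws. is_play G P ((vs @ [w]) @ ws)"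
      using less.hyps[OF _ r'] root_path_length[OF r'] by simp
    then show ?thesis by auto
  next
    case False
    then have v: "v \<in> leaves G" using root_path_in[OF r] by (auto simp: inner_nodes_def)
    have "mover G (vs ! k) \<in> {1..n}" if "Suc k < length vs" for k
      using r is_path_edge[OF _ that] source_inner mover_in by (auto simp: root_path_def)
    then have "is_play G P (vs @ [])"
      using r v less.prems(2) by (auto simp: is_play_def root_path_def profiles_consistent_iff)
    then show ?thesis by blast
  qed
qed

text \<open>Disjoint labels force equal moves at equal nodes, and neither play can extend the other
  beyond its leaf.\<close>

lemma play_unique:
  assumes "is_play G P vs" "is_play G P ws"
  shows "vs = ws"
proof -
  have agree: "k < length vs \<Longrightarrow> k < length ws \<Longrightarrow> vs ! k = ws ! k" for k
  proof (induction k)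
    case 0
    then show ?case using assms by (auto simp: is_play_def hd_conv_nth)
  next
    case (Suc k)
    have same: "vs ! k = ws ! k" using Suc by simp
    have "(vs ! k, vs ! Suc k) \<in> edges G" "(ws ! k, ws ! Suc k) \<in> edges G"
      using assms Suc.prems is_path_edge by (auto simp: is_play_def)
    moreover have "P (mover G (vs ! k)) \<in> edge_prefs G (vs ! k, vs ! Suc k)"
      "P (mover G (ws ! k)) \<in> edge_prefs G (ws ! k, ws ! Suc k)"
      using assms Suc.prems by (auto simp: is_play_def)
    ultimately have "(vs ! k, vs ! Suc k) = (ws ! k, ws ! Suc k)"
      using edge_prefs_disj same by (metis disjoint_iff fst_conv)
    then show ?case by simp
  qed
  have no_longer: "\<not> length us < length us'" if us: "is_play G P us" "is_play G P us'"
    "\<And>k. k < length us \<Longrightarrow> k < length us' \<Longrightarrow> us ! k = us' ! k" for us us'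
  proof
    assume l: "length us < length us'"
    have ne: "us \<noteq> []" using us(1) by (simp add: is_play_def is_path_def)
    have "(us' ! (length us - 1), us' ! length us) \<in> edges G"
      using us(2) is_path_edge[of G us' "length us - 1"] l ne by (simp add: is_play_def)
    moreover have "us' ! (length us - 1) = last us" using us(3)[of "length us - 1"] l ne
      by (simp add: last_conv_nth)
    ultimately have "last us \<in> inner_nodes G" using source_inner by metis
    then show False using us(1) by (simp add: is_play_def inner_nodes_def)
  qed
  have "length vs = length ws"
    using no_longer[OF assms agree] no_longer[OF assms(2,1)] agree by fastforce
  then show ?thesis using agree by (simp add: nth_equalityI)
qed

lemma play_eq: "is_play G P vs \<Longrightarrow> play G P = vs"
  unfolding play_def using play_unique by blast

lemma is_play_play: "P \<in> profiles n Ps \<Longrightarrow> is_play G P (play G P)"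
  using play_extends[OF root_path_root, of P] play_eq by (auto simp: consistent_single)

text \<open>Together with \<open>consistent_if_passes\<close> this identifies the profiles passing
  through a node with a box.\<close>

lemma passes_if_consistent:
  assumes "root_path G v vs" "P \<in> profiles n (consistent G Ps vs)"
  shows "passes G P v"
proof -
  have "vs \<noteq> []" "last vs = v" using assms(1) by (auto simp: root_path_def is_path_def)
  then show ?thesis using play_extends[OF assms] play_eq by (auto simp: passes_def)
qed

lemma consistent_if_passes:
  assumes "passes G P v" "P \<in> profiles n Ps" "root_path G v vs"
  shows "P \<in> profiles n (consistent G Ps vs)"
proof -
  obtain k where k: "k < length (play G P)" "play G P ! k = v"
    using assms(1) by (auto simp: passes_def in_set_conv_nth)
  note p = is_play_play[OF assms(2)]
  have "root_path G v (take (Suc k) (play G P))"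
    using root_path_take[of G "play G P" k] p k by (auto simp: is_play_def)
  then have vs: "vs = take (Suc k) (play G P)"
    using root_path_unique[OF root_path_in[OF assms(3)] assms(3)] by simp
  have "P (mover G (vs ! j)) \<in> edge_prefs G (vs ! j, vs ! Suc j)" if "Suc j < length vs" for j
    using p that by (auto simp: is_play_def vs)
  then show ?thesis using assms(2) by (auto simp: profiles_consistent_iff)
qed

lemma in_edge_if_passes:
  assumes "passes G P v" "P \<in> profiles n Ps" "v \<in> inner_nodes G"
  shows "\<exists>e\<in>out_edges G v. P (mover G v) \<in> edge_prefs G e"
proof -
  have "v \<in> nodes G" using assms(3) by (auto simp: inner_nodes_def)
  then obtain vs where vs: "root_path G v vs" using root_path_exists by blast
  have "P (mover G v) \<in> consistent G Ps vs (mover G v)"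
    using profilesD[OF consistent_if_passes[OF assms(1,2) vs] mover_in[OF assms(3)]] .
  then show ?thesis using union_out_edges[OF vs assms(3)] by blast
qed

section \<open>Simple OSP mechanisms are SOSP\<close>

lemma simple_osp_imp_sosp:
  assumes simple: "simple G" and osp: "osp n Ps G"
  shows "sosp n Ps G"
  unfolding sosp_def
proof (intro ballI impI, elim conjE)
  fix i v P P' Pt
  assume i: "i \<in> {1..n}" and v: "v \<in> inner_nodes G" "mover G v = i"
    and P: "P \<in> profiles n Ps" "P' \<in> profiles n Ps" "Pt \<in> profiles n Ps"
    and pass: "passes G P v" "passes G P' v" "passes G Pt v"
    and div: "\<not> diverge G i v (P i) (P' i)" "diverge G i v (P i) (Pt i)"
  define P'' where "P'' = P'(i := P i)"
  let ?ws = "play G P'"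
  have p: "is_play G P' ?ws" using is_play_play P by blast
  obtain e where e: "e \<in> out_edges G v" "P i \<in> edge_prefs G e"
    using in_edge_if_passes[OF pass(1) P(1) v(1)] v(2) by blast
  have "is_play G P'' ?ws"
    unfolding is_play_def
  proof (intro conjI allI impI)
    fix k assume k: "Suc k < length ?ws"
    have P'k: "P' (mover G (?ws ! k)) \<in> edge_prefs G (?ws ! k, ?ws ! Suc k)"
      and ek: "(?ws ! k, ?ws ! Suc k) \<in> edges G"
      using p k is_path_edge by (auto simp: is_play_def)
    show "P'' (mover G (?ws ! k)) \<in> edge_prefs G (?ws ! k, ?ws ! Suc k)"
    proof (cases "mover G (?ws ! k) = i")
      case True
      have "?ws ! k \<in> set ?ws \<inter> inner_nodes G" "v \<in> set ?ws \<inter> inner_nodes G"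
        using k source_inner[OF ek] pass(2) v(1) by (auto simp: passes_def)
      then have eq: "?ws ! k = v" using simple p True v(2) unfolding simple_def is_play_def by metis
      then have "(?ws ! k, ?ws ! Suc k) \<in> out_edges G v" using ek by (simp add: out_edges_def)
      \<comment> \<open>The types \<open>P i\<close> and \<open>P' i\<close> do not diverge at
        \<open>v\<close>, so both belong to the edge taken by the play.\<close>
      then have "e = (?ws ! k, ?ws ! Suc k)"
        using div(1) e P'k v(2) True eq by (auto simp: diverge_def)
      then show ?thesis using e True by (simp add: P''_def)
    qed (use P'k in \<open>simp add: P''_def\<close>)
  qed (use p in \<open>auto simp: is_play_def\<close>)
  then have play: "play G P'' = ?ws" by (rule play_eq)
  have P'': "P'' \<in> profiles n Ps"
    using profiles_upd[OF P(2) i profilesD[OF P(1) i]] by (simp add: P''_def)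
  have "passes G P'' v" using pass(2) play by (simp add: passes_def)
  moreover have "diverge G i v (P'' i) (Pt i)" using div(2) by (simp add: P''_def)
  ultimately have "(result G P'' i, result G Pt i) \<in> (P'' i)\<^sup>="
    using osp[unfolded osp_def, rule_format, OF i v P'' P(3)] pass(3) by blast
  then show "(result G P' i, result G Pt i) \<in> (P i)\<^sup>="
    using play by (simp add: result_def P''_def)
qed

section \<open>The game played by an SOSP mechanism\<close>

text \<open>Passing through \<open>v\<close> means lying in the box at \<open>v\<close>, so the SOSP
  condition at \<open>v\<close> becomes \<open>sosp_choice\<close> for the labels of its outgoing
  edges.\<close>

lemma sosp_game_at:
  assumes sosp: "sosp n Ps G" and f: "\<And>P. P \<in> profiles n Ps \<Longrightarrow> f P = result G P"
    and "root_path G v vs"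
  shows "sosp_game n (allocations n A a0) f (consistent G Ps vs)"
  using assms(3)
proof (induction "card (nodes G) - length vs" arbitrary: v vs rule: less_induct)
  case less
  note r = less.prems
  let ?D = "consistent G Ps vs"
  have sub: "profiles n ?D \<subseteq> profiles n Ps" by (intro profiles_mono) (auto simp: consistent_def)
  have l: "last vs = v" using r by (simp add: root_path_def)
  show ?case
  proof (cases "v \<in> inner_nodes G")
    case False
    then have v: "v \<in> leaves G" using root_path_in[OF r] by (auto simp: inner_nodes_def)
    show ?thesis
    proof (rule sosp_game.leaf[OF leaf_alloc_in[OF v]])
      fix P assume P: "P \<in> profiles n ?D"
      have "mover G (vs ! k) \<in> {1..n}" if "Suc k < length vs" for k
        using r is_path_edge[OF _ that] source_inner mover_in by (auto simp: root_path_def)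
      then have "is_play G P vs"
        using r v P l by (auto simp: is_play_def root_path_def profiles_consistent_iff)
      then show "f P = leaf_alloc G v" using f P sub l play_eq by (auto simp: result_def)
    qed
  next
    case True
    let ?i = "mover G v" and ?KK = "edge_prefs G ` out_edges G v"
    have out: "e \<in> edges G" "fst e = v" if "e \<in> out_edges G v" for e
      using that by (auto simp: out_edges_def)
    have child: "consistent G Ps (vs @ [snd e]) = ?D(?i := edge_prefs G e)" if "e \<in> out_edges G v" for e
      using consistent_child[OF r, of "snd e"] out[OF that] by (metis prod.collapse)
    have step: "root_path G (snd e) (vs @ [snd e])" if "e \<in> out_edges G v" for e
      using root_path_snoc[OF r] out[OF that] by (metis prod.collapse)
    show ?thesis
    proof (rule sosp_game.node[OF mover_in[OF True]])
      have "finite (edges G)" using finite_nodes edges_sub by (metis finite_SigmaI finite_subset)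
      then have "finite ?KK" by (auto simp: out_edges_def)
      moreover have "disjoint ?KK"
        unfolding disjoint_def using edge_prefs_disj out by (smt (verit, best) imageE)
      moreover have "{} \<notin> ?KK" using edge_prefs_ne out by fastforce
      ultimately show "is_split (?D ?i) ?KK"
        using union_out_edges[OF r True] by (simp add: is_split_def)
      show "?KK \<noteq> {}" using True by (auto simp: inner_nodes_def leaves_def)
      show "sosp_game n (allocations n A a0) f (?D(?i := K))" if "K \<in> ?KK" for K
      proof -
        from that obtain e where e: "e \<in> out_edges G v" "K = edge_prefs G e" by blast
        have "sosp_game n (allocations n A a0) f (consistent G Ps (vs @ [snd e]))"
          using root_path_length[OF step[OF e(1)]] by (intro less.hyps[OF _ step[OF e(1)]]) simp
        then show ?thesis using child e by simp
      qed
      have "(f Q ?i, f R ?i) \<in> p\<^sup>="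
        if KL: "K \<in> ?KK" "L \<in> ?KK" "K \<noteq> L" and p: "p \<in> K"
          and Q: "Q \<in> profiles n (?D(?i := K))" and R: "R \<in> profiles n (?D(?i := L))" for K L p Q R
      proof -
        obtain e where e: "e \<in> out_edges G v" "K = edge_prefs G e" using KL by blast
        obtain e' where e': "e' \<in> out_edges G v" "L = edge_prefs G e'" using KL by blast
        \<comment> \<open>\<open>sosp\<close> needs a whole profile to carry the reference type;
          \<open>Q\<close> with \<open>p\<close> inserted also passes through
          \<open>v\<close>.\<close>
        let ?P = "Q(?i := p)"
        have subD: "profiles n (?D(?i := edge_prefs G e)) \<subseteq> profiles n ?D" if "e \<in> out_edges G v" for e
          using union_out_edges[OF r True] that by (intro profiles_mono) auto
        have P: "?P \<in> profiles n (?D(?i := K))"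
          using profiles_upd[OF Q mover_in[OF True] p] by simp
        have box: "?P \<in> profiles n ?D" "Q \<in> profiles n ?D" "R \<in> profiles n ?D"
          using P Q R subD e e' by blast+
        have QR: "Q ?i \<in> K" "R ?i \<in> L"
          using profilesD[OF Q mover_in[OF True]] profilesD[OF R mover_in[OF True]] by auto
        have "\<not> diverge G ?i v (?P ?i) (Q ?i)"
        proof
          assume "diverge G ?i v (?P ?i) (Q ?i)"
          then obtain d d' where d: "d \<in> out_edges G v" "d' \<in> out_edges G v" "d \<noteq> d'"
            "p \<in> edge_prefs G d" "Q ?i \<in> edge_prefs G d'" by (auto simp: diverge_def)
          have "d = e" "d' = e"
            using edge_prefs_disj out d e p QR(1) by (metis disjoint_iff)+
          then show False using d by simp
        qed
        moreover have "e \<noteq> e'" using e e' KL(3) by blast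
        then have "diverge G ?i v (?P ?i) (R ?i)"
          using e e' p QR by (auto simp: diverge_def)
        moreover have "passes G ?P v" "passes G Q v" "passes G R v"
          using passes_if_consistent[OF r] box by blast+
        moreover have prof: "?P \<in> profiles n Ps" "Q \<in> profiles n Ps" "R \<in> profiles n Ps"
          using box sub by blast+
        ultimately have "(result G Q ?i, result G R ?i) \<in> (?P ?i)\<^sup>="
          using sosp[unfolded sosp_def, rule_format, OF mover_in[OF True] True refl prof] by blast
        then show ?thesis using f prof by simp
      qed
      then show "sosp_choice n f ?D ?i ?KK" unfolding sosp_choice_def by blast
    qed
  qed
qed

lemma sosp_game_root:
  assumes "sosp n Ps G" "\<And>P. P \<in> profiles n Ps \<Longrightarrow> f P = result G P"
  shows "sosp_game n (allocations n A a0) f Ps"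
  using sosp_game_at[OF assms root_path_root] by (simp add: consistent_single)

end

section \<open>Mechanisms from game trees\<close>

fun subtree :: "'a game_tree \<Rightarrow> nat list \<Rightarrow> 'a game_tree option" where
  "subtree t [] = Some t"
| "subtree (Leaf \<mu>) (k # p) = None"
| "subtree (Branch i ks) (k # p) = (if k < length ks then subtree (snd (ks ! k)) p else None)"

text \<open>The recursion of \<open>subtree\<close> consumes a position from the front, whereas
  paths from the root grow at its end.\<close>

lemma subtree_snoc:
  "subtree t (p @ [k]) = (case subtree t p of
     Some (Branch i ks) \<Rightarrow> if k < length ks then Some (snd (ks ! k)) else None
   | _ \<Rightarrow> None)"
  by (induction t p rule: subtree.induct) (auto split: game_tree.splits)

lemma subtree_snoc_Some:
  assumes "subtree t (p @ [k]) = Some u"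
  obtains i ks where "subtree t p = Some (Branch i ks)" "k < length ks" "u = snd (ks ! k)"
  using assms by (auto simp: subtree_snoc split: option.splits game_tree.splits if_splits)

lemma finite_positions: "finite {p. subtree t p \<noteq> None}"
proof (induction t)
  case (Leaf \<mu>)
  have "{p. subtree (Leaf \<mu>) p \<noteq> None} \<subseteq> {[]}"
  proof
    fix p assume "p \<in> {p. subtree (Leaf \<mu>) p \<noteq> None}"
    then show "p \<in> {[]}" by (cases p) auto
  qed
  then show ?case by (rule finite_subset) simp
next
  case (Branch i ks)
  let ?Q = "\<lambda>k. {p. subtree (snd (ks ! k)) p \<noteq> None}"
  have sub: "{p. subtree (Branch i ks) p \<noteq> None} \<subseteq> insert [] (\<Union>k<length ks. (#) k ` ?Q k)"
  proof
    fix p assume "p \<in> {p. subtree (Branch i ks) p \<noteq> None}"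
    then show "p \<in> insert [] (\<Union>k<length ks. (#) k ` ?Q k)"
      by (cases p) (auto split: if_splits)
  qed
  have "finite (?Q k)" if "k < length ks" for k
    using Branch.IH[OF nth_mem[OF that], of "snd (ks ! k)"] by (cases "ks ! k") (auto simp: snds.simps)
  then have "finite (insert [] (\<Union>k<length ks. (#) k ` ?Q k))" by blast
  then show ?case by (rule finite_subset[OF sub])
qed

declare list_encode.simps [simp del]

text \<open>Implementability asks for natural numbers as nodes, hence the encoding of positions. The
  last index in the position of an edge's target tells which child it is, and so which class labels
  the edge.\<close>

definition mechanism_of :: "'a game_tree \<Rightarrow> (nat, 'a) mechanism" where
  "mechanism_of t =
    \<lparr>nodes = list_encode ` {p. subtree t p \<noteq> None},
     edges = {(list_encode p, list_encode (p @ [k])) | p k. subtree t (p @ [k]) \<noteq> None},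
     root_node = list_encode [],
     leaf_alloc = (\<lambda>v. case the (subtree t (list_decode v)) of Leaf \<mu> \<Rightarrow> \<mu> | _ \<Rightarrow> undefined),
     mover = (\<lambda>v. case the (subtree t (list_decode v)) of Branch i _ \<Rightarrow> i | _ \<Rightarrow> undefined),
     edge_prefs = (\<lambda>(u, v). case the (subtree t (list_decode u)) of
        Branch _ ks \<Rightarrow> fst (ks ! last (list_decode v)) | _ \<Rightarrow> undefined)\<rparr>"

definition position_path :: "nat list \<Rightarrow> nat list" where
  "position_path p = map list_encode (prefixes p)"

lemma position_path_simps [simp]:
  "position_path (p @ [k]) = position_path p @ [list_encode (p @ [k])]"
  "position_path [] = [list_encode []]"
  "position_path p \<noteq> []"
  "hd (position_path p) = list_encode []"
  "last (position_path p) = list_encode p"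
  "set (position_path p) = list_encode ` {q. prefix q p}"
  by (auto simp: position_path_def hd_map last_map)

lemma butlast_position_path: "set (butlast (position_path p)) = list_encode ` {q. strict_prefix q p}"
  by (cases p rule: rev_cases) (auto simp: strict_prefix_def)

context
  fixes t :: "'a game_tree" and G :: "(nat, 'a) mechanism"
  assumes G_def: "G = mechanism_of t"
begin

lemma nodes_of: "list_encode p \<in> nodes G \<longleftrightarrow> subtree t p \<noteq> None"
  by (auto simp: G_def mechanism_of_def list_encode_eq)

lemma node_cases:
  assumes "v \<in> nodes G"
  obtains p u where "v = list_encode p" "subtree t p = Some u"
  using assms by (auto simp: G_def mechanism_of_def)

lemma edges_of:
  "(list_encode p, w) \<in> edges G \<longleftrightarrow> (\<exists>k. w = list_encode (p @ [k]) \<and> subtree t (p @ [k]) \<noteq> None)"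
  by (auto simp: G_def mechanism_of_def list_encode_eq)

lemma mover_of: "subtree t p = Some (Branch i ks) \<Longrightarrow> mover G (list_encode p) = i"
  by (simp add: G_def mechanism_of_def)

lemma leaf_alloc_of: "subtree t p = Some (Leaf \<mu>) \<Longrightarrow> leaf_alloc G (list_encode p) = \<mu>"
  by (simp add: G_def mechanism_of_def)

lemma edge_prefs_of:
  "subtree t p = Some (Branch i ks) \<Longrightarrow> edge_prefs G (list_encode p, list_encode (p @ [k])) = fst (ks ! k)"
  by (simp add: G_def mechanism_of_def)

lemma root_of: "root_node G = list_encode []"
  by (simp add: G_def mechanism_of_def)

lemma edges_of_sub: "edges G \<subseteq> nodes G \<times> nodes G"
proof
  fix e assume "e \<in> edges G"
  then obtain p k where e: "e = (list_encode p, list_encode (p @ [k]))" "subtree t (p @ [k]) \<noteq> None"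
    by (auto simp: G_def mechanism_of_def)
  then have "subtree t p \<noteq> None" by (auto simp: subtree_snoc split: option.splits)
  then show "e \<in> nodes G \<times> nodes G" using e nodes_of by simp
qed

lemma out_edges_Branch:
  assumes "subtree t p = Some (Branch i ks)"
  shows "out_edges G (list_encode p) =
    (\<lambda>k. (list_encode p, list_encode (p @ [k]))) ` {..<length ks}"
  using assms edges_of[of p] by (auto simp: out_edges_def subtree_snoc split: if_splits)

lemma out_edges_Leaf: "subtree t p = Some (Leaf \<mu>) \<Longrightarrow> out_edges G (list_encode p) = {}"
  using edges_of[of p] by (auto simp: out_edges_def subtree_snoc)

lemma root_path_of: "subtree t p \<noteq> None \<Longrightarrow> root_path G (list_encode p) (position_path p)"
proof (induction p rule: rev_induct)
  case Nil
  then show ?case using nodes_of[of "[]"] by (simp add: root_path_def is_path_def root_of)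
next
  case (snoc k p)
  then have "subtree t p \<noteq> None" by (auto simp: subtree_snoc split: option.splits)
  then show ?case
    using snoc nodes_of[of "p @ [k]"] edges_of[of p "list_encode (p @ [k])"]
    by (auto simp: root_path_def is_path_def successively_append_iff root_of
        simp del: position_path_simps(6))
qed

text \<open>Each edge appends one index to a position, so the last node determines the whole path;
  this is the uniqueness demanded of a rooted tree.\<close>

lemma path_from_root:
  "is_path G vs \<Longrightarrow> hd vs = root_node G \<Longrightarrow> vs = position_path (list_decode (last vs))"
proof (induction vs rule: rev_induct)
  case (snoc v vs)
  show ?case
  proof (cases "vs = []")
    case True
    then show ?thesis using snoc.prems by (simp add: root_of)
  next
    case False
    have vs: "is_path G vs" "hd vs = root_node G" "(last vs, v) \<in> edges G"
      using snoc.prems False by (auto simp: is_path_def successively_append_iff)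
    then have "last vs \<in> nodes G" using edges_of_sub by blast
    then obtain p where p: "last vs = list_encode p" by (rule node_cases)
    then obtain k where "v = list_encode (p @ [k])" using vs(3) edges_of by auto
    then show ?thesis using snoc.IH[OF vs(1,2)] p by simp
  qed
qed (simp add: is_path_def)

lemma root_path_of_iff:
  "root_path G (list_encode p) vs \<longleftrightarrow> subtree t p \<noteq> None \<and> vs = position_path p"
proof
  assume r: "root_path G (list_encode p) vs"
  then have "list_encode p \<in> nodes G"
    unfolding root_path_def is_path_def by (metis last_in_set subsetD)
  then show "subtree t p \<noteq> None \<and> vs = position_path p"
    using r path_from_root[of vs] nodes_of by (simp add: root_path_def)
qed (use root_path_of in simp)

lemma rooted_tree_of: "is_rooted_tree G"
  unfolding is_rooted_tree_def
proof (intro conjI ballI edges_of_sub)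
  have "nodes G = list_encode ` {p. subtree t p \<noteq> None}" by (simp add: G_def mechanism_of_def)
  then show "finite (nodes G)" by (simp only: finite_imageI finite_positions)
  show "root_node G \<in> nodes G" using nodes_of[of "[]"] by (simp add: root_of)
  fix v assume "v \<in> nodes G"
  then obtain p u where "v = list_encode p" "subtree t p = Some u" by (rule node_cases)
  then show "\<exists>!vs. root_path G v vs" using root_path_of_iff by simp
qed

section \<open>The mechanism of a simple game\<close>

context
  fixes n :: nat and A :: "'a set" and a0 :: 'a and f :: "'a profile \<Rightarrow> 'a alloc"
    and Ps :: "nat \<Rightarrow> 'a pref set"
  assumes game: "simple_game n (allocations n A a0) f Ps {1..n} t"
    and Ps: "\<And>i. Ps i \<subseteq> strict_orders (insert a0 A)"
begin

abbreviation "box_at p \<equiv> consistent G Ps (position_path p)"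

text \<open>Each class lies inside the mover's factor, so intersecting with its label along the path
  is the update \<open>D(i := K)\<close> made by the game. The movers at strict prefixes are those
  removed from the set of agents who may still move.\<close>

lemma simple_game_at:
  "subtree t p = Some u \<Longrightarrow> simple_game n (allocations n A a0) f (box_at p)
     ({1..n} - mover G ` list_encode ` {q. strict_prefix q p}) u"
proof (induction p arbitrary: u rule: rev_induct)
  case Nil
  then show ?case using game by (simp add: consistent_single)
next
  case (snoc k p)
  let ?S = "{1..n} - mover G ` list_encode ` {q. strict_prefix q p}"
  obtain i ks where p: "subtree t p = Some (Branch i ks)" "k < length ks" "u = snd (ks ! k)"
    using snoc.prems by (rule subtree_snoc_Some)
  from snoc.IH[OF p(1)] show ?case
  proof cases
    case branch
    have "(fst (ks ! k), u) \<in> set ks" using p by simp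
    then have g: "simple_game n (allocations n A a0) f ((box_at p)(i := fst (ks ! k))) (?S - {i}) u"
      by (rule branch(7))
    have "fst (ks ! k) \<subseteq> \<Union>(fst ` set ks)" using p by (intro Union_upper) simp
    then have "fst (ks ! k) \<subseteq> box_at p i" using branch(5) by (simp add: is_split_def)
    then have "box_at (p @ [k]) = (box_at p)(i := fst (ks ! k))"
      using consistent_snoc[of "position_path p" G Ps "list_encode (p @ [k])"]
      by (simp add: mover_of[OF p(1)] edge_prefs_of[OF p(1)] Int_absorb1)
    moreover have "{q. strict_prefix q (p @ [k])} = insert p {q. strict_prefix q p}"
      by (auto simp: strict_prefix_def)
    then have "{1..n} - mover G ` list_encode ` {q. strict_prefix q (p @ [k])} = ?S - {i}"
      using mover_of[OF p(1)] by auto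
    ultimately show ?thesis using g by (simp only:)
  qed
qed

lemma branch_at:
  assumes "subtree t p = Some (Branch i ks)"
  shows "i \<in> {1..n}" "i \<notin> mover G ` list_encode ` {q. strict_prefix q p}" "ks \<noteq> []"
    "distinct (map fst ks)" "is_split (box_at p i) (fst ` set ks)"
    "K \<in> fst ` set ks \<Longrightarrow> L \<in> fst ` set ks \<Longrightarrow> K \<noteq> L \<Longrightarrow> P \<in> profiles n ((box_at p)(i := K)) \<Longrightarrow>
       R \<in> profiles n ((box_at p)(i := L)) \<Longrightarrow> (f P i, f R i) \<in> (P i)\<^sup>="
proof -
  note g = simple_game_at[OF assms]
  show "i \<in> {1..n}" using g by cases assumption
  show "i \<notin> mover G ` list_encode ` {q. strict_prefix q p}" using g by cases simp
  show "ks \<noteq> []" using g by cases assumption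
  show "distinct (map fst ks)" using g by cases assumption
  show "is_split (box_at p i) (fst ` set ks)" using g by cases assumption
  show "(f P i, f R i) \<in> (P i)\<^sup>="
    if "K \<in> fst ` set ks" "L \<in> fst ` set ks" "K \<noteq> L" "P \<in> profiles n ((box_at p)(i := K))"
      "R \<in> profiles n ((box_at p)(i := L))"
    using g
  proof cases
    case branch
    then show ?thesis using branch(6)[OF that] by simp
  qed
qed

lemma leaf_at:
  assumes "subtree t p = Some (Leaf \<mu>)"
  shows "\<mu> \<in> allocations n A a0" "P \<in> profiles n (box_at p) \<Longrightarrow> f P = \<mu>"
proof -
  note g = simple_game_at[OF assms]
  show "\<mu> \<in> allocations n A a0" using g by cases assumption
  show "f P = \<mu>" if "P \<in> profiles n (box_at p)" using g by cases (simp add: that)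
qed

lemma inner_node_cases:
  assumes "v \<in> inner_nodes G"
  obtains p i ks where "v = list_encode p" "subtree t p = Some (Branch i ks)"
proof -
  have "v \<in> nodes G" "out_edges G v \<noteq> {}" using assms by (auto simp: inner_nodes_def leaves_def)
  then show ?thesis using that out_edges_Leaf by (metis game_tree.exhaust node_cases)
qed

lemma leaf_cases:
  assumes "v \<in> leaves G"
  obtains p \<mu> where "v = list_encode p" "subtree t p = Some (Leaf \<mu>)"
proof -
  have v: "v \<in> nodes G" "out_edges G v = {}" using assms by (auto simp: leaves_def)
  obtain p u where p: "v = list_encode p" "subtree t p = Some u" using v(1) by (rule node_cases)
  have "\<exists>\<mu>. u = Leaf \<mu>"
  proof (cases u)
    case (Branch i ks)
    then show ?thesis using out_edges_Branch branch_at(3) p v(2) by fastforce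
  qed simp
  then show ?thesis using that p by blast
qed

lemma edge_cases:
  assumes "e \<in> edges G"
  obtains p i ks k where "e = (list_encode p, list_encode (p @ [k]))"
    "subtree t p = Some (Branch i ks)" "k < length ks"
proof -
  obtain p k where "e = (list_encode p, list_encode (p @ [k]))" "subtree t (p @ [k]) \<noteq> None"
    using assms by (auto simp: G_def mechanism_of_def)
  then show ?thesis using that subtree_snoc_Some by (metis not_None_eq)
qed

text \<open>The mover at \<open>p\<close> is none of the movers at strict prefixes. So no node has
  an earlier move to refer to, and every mover splits her full factor.\<close>

lemma box_first_move:
  assumes "subtree t p = Some (Branch i ks)"
  shows "box_at p i = Ps i" "\<not> last_move G (position_path p) k"
proof -
  have *: "mover G (position_path p ! k) \<noteq> i" if "Suc k < length (position_path p)" for k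
  proof -
    have "position_path p ! k \<in> set (butlast (position_path p))"
      using that by (metis Suc_lessE diff_Suc_1 length_butlast nth_butlast nth_mem Suc_less_eq)
    then show ?thesis using branch_at(2)[OF assms] unfolding butlast_position_path by blast
  qed
  then show "box_at p i = Ps i" by (auto simp: consistent_def)
  show "\<not> last_move G (position_path p) k"
    using * mover_of[OF assms] by (auto simp: last_move_def)
qed

lemma mechanism_of_mechanism: "is_mechanism n A a0 Ps G"
  unfolding is_mechanism_def
proof (intro conjI ballI allI impI)
  show "is_rooted_tree G" by (rule rooted_tree_of)
  show "leaf_alloc G v \<in> allocations n A a0" if "v \<in> leaves G" for v
    using that leaf_alloc_of leaf_at(1) by (metis leaf_cases)
  show "mover G v \<in> {1..n}" if "v \<in> inner_nodes G" for v
    using that mover_of branch_at(1) by (metis inner_node_cases)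
  fix e assume "e \<in> edges G"
  then obtain p i ks k where e: "e = (list_encode p, list_encode (p @ [k]))"
    "subtree t p = Some (Branch i ks)" "k < length ks" by (rule edge_cases)
  have K: "edge_prefs G e = fst (ks ! k)" "fst (ks ! k) \<in> fst ` set ks"
    using e edge_prefs_of by auto
  then show "edge_prefs G e \<noteq> {}" using branch_at(5)[OF e(2)] unfolding is_split_def by metis
  show "edge_prefs G e \<subseteq> strict_orders (insert a0 A)"
  proof -
    have "edge_prefs G e \<subseteq> \<Union>(fst ` set ks)" unfolding K(1) using K(2) by (rule Union_upper)
    then show ?thesis
      using branch_at(5)[OF e(2)] box_first_move(1)[OF e(2)] Ps[of i] unfolding is_split_def by simp
  qed
  fix e' assume "e' \<in> edges G" and ee: "fst e = fst e' \<and> e \<noteq> e'"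
  then obtain p' i' ks' k' where e': "e' = (list_encode p', list_encode (p' @ [k']))"
    "subtree t p' = Some (Branch i' ks')" "k' < length ks'" by (metis edge_cases)
  have same: "p' = p" "i' = i" "ks' = ks" "k \<noteq> k'" using e e' ee by (auto simp: list_encode_eq)
  \<comment> \<open>Disjointness holds for different classes; that different children carry
    different classes is the distinctness built into \<open>simple_game\<close>.\<close>
  then have "fst (ks ! k) \<noteq> fst (ks ! k')"
    using branch_at(4)[OF e(2)] e(3) e'(3) by (metis length_map nth_eq_iff_index_eq nth_map)
  moreover have "fst (ks ! k') \<in> fst ` set ks" using e'(3) same by simp
  ultimately show "edge_prefs G e \<inter> edge_prefs G e' = {}"
    using branch_at(5)[OF e(2)] K same edge_prefs_of[OF e(2)] e'(1)
    unfolding is_split_def disjoint_def by (metis (no_types, lifting))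
next
  fix v vs assume "v \<in> inner_nodes G" and r: "root_path G v vs"
  then obtain p i ks where p: "v = list_encode p" "subtree t p = Some (Branch i ks)"
    by (metis inner_node_cases)
  have vs: "vs = position_path p" using r p root_path_of_iff by simp
  show "(\<Union>e\<in>out_edges G v. edge_prefs G e) = edge_prefs G (vs ! k, vs ! Suc k)"
    if "last_move G vs k" for k
    using that box_first_move(2)[OF p(2)] vs by simp
  have "fst ` set ks = (\<lambda>k. fst (ks ! k)) ` {..<length ks}"
    by (auto simp: set_conv_nth image_iff)
  then have "(\<Union>e\<in>out_edges G v. edge_prefs G e) = \<Union>(fst ` set ks)"
    by (simp add: p(1) out_edges_Branch[OF p(2)] edge_prefs_of[OF p(2)])
  also have "\<dots> = box_at p i" using branch_at(5)[OF p(2)] by (simp only: is_split_def)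
  also have "\<dots> = Ps i" by (rule box_first_move(1)[OF p(2)])
  also have "i = mover G v" by (simp add: p(1) mover_of[OF p(2)])
  finally show "(\<Union>e\<in>out_edges G v. edge_prefs G e) = Ps (mover G v)" .
qed

lemma mechanism_of_simple: "simple G"
  unfolding simple_def
proof (intro allI impI ballI)
  fix vs v v'
  assume vs: "is_path G vs" and v: "v \<in> set vs \<inter> inner_nodes G" "v' \<in> set vs \<inter> inner_nodes G" "v \<noteq> v'"
  have "hd vs \<in> nodes G" using vs unfolding is_path_def by (metis hd_in_set subsetD)
  then obtain q u where q: "hd vs = list_encode q" "subtree t q = Some u" by (rule node_cases)
  have r: "root_path G (hd vs) (position_path q)" using q root_path_of by simp
  \<comment> \<open>A path in \<open>simple\<close> may start anywhere. It is prolonged backwards to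
    the root, so that all its nodes are prefixes of one position.\<close>
  define ws where "ws = butlast (position_path q) @ vs"
  have decomp: "position_path q = butlast (position_path q) @ [hd vs]"
    using q(1) by (metis append_butlast_last_id position_path_simps(3,5))
  have "is_path G (butlast (position_path q) @ [hd vs])" "hd (butlast (position_path q) @ [hd vs]) = root_node G"
    using r decomp by (auto simp: root_path_def)
  then have "is_path G ws" "hd ws = root_node G"
    using vs unfolding ws_def is_path_def
    by (auto simp: successively_append_iff hd_append split: if_splits)
  then obtain p where "ws = position_path p" using path_from_root by blast
  then have sub: "set vs \<subseteq> list_encode ` {q. prefix q p}"
    by (metis Un_upper2 position_path_simps(6) set_append ws_def)
  obtain a where a: "v = list_encode a" "prefix a p" using v(1) sub by auto
  obtain b where b: "v' = list_encode b" "prefix b p" using v(2) sub by auto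
  obtain i ks where i: "subtree t a = Some (Branch i ks)"
    using v(1) a(1) by (metis IntD2 inner_node_cases list_encode_eq)
  obtain j ls where j: "subtree t b = Some (Branch j ls)"
    using v(2) b(1) by (metis IntD2 inner_node_cases list_encode_eq)
  \<comment> \<open>Prefixes of one position are comparable, and the mover at the shorter one no
    longer moves at the longer one.\<close>
  have "strict_prefix a b \<or> strict_prefix b a"
    using a b v(3) prefix_same_cases unfolding strict_prefix_def by blast
  then have "mover G v \<in> mover G ` list_encode ` {q. strict_prefix q b} \<or>
      mover G v' \<in> mover G ` list_encode ` {q. strict_prefix q a}"
    using a(1) b(1) by blast
  then show "mover G v \<noteq> mover G v'"
    using branch_at(2)[OF i] branch_at(2)[OF j] mover_of[OF i] mover_of[OF j] a(1) b(1) by metis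
qed

lemma mechanism_of_result:
  assumes "P \<in> profiles n Ps"
  shows "f P = result G P"
proof -
  interpret game n A a0 Ps G by unfold_locales (rule mechanism_of_mechanism)
  have p: "is_play G P (play G P)" using is_play_play[OF assms] .
  then have "last (play G P) \<in> leaves G" by (simp add: is_play_def)
  then obtain p \<mu> where q: "last (play G P) = list_encode p" "subtree t p = Some (Leaf \<mu>)"
    by (rule leaf_cases)
  have "play G P = position_path p" using path_from_root[of "play G P"] p q by (simp add: is_play_def)
  then have "P \<in> profiles n (box_at p)"
    using p assms by (auto simp: profiles_consistent_iff is_play_def)
  then show ?thesis using leaf_at(2)[OF q(2)] leaf_alloc_of[OF q(2)] q(1) by (simp add: result_def)
qed

lemma mechanism_of_osp: "osp n Ps G"
  unfolding osp_def
proof (intro ballI impI, elim conjE)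
  interpret game n A a0 Ps G by unfold_locales (rule mechanism_of_mechanism)
  fix i v P R
  assume i: "i \<in> {1..n}" and v: "v \<in> inner_nodes G" "mover G v = i"
    and P: "P \<in> profiles n Ps" "R \<in> profiles n Ps" and pass: "passes G P v" "passes G R v"
    and div: "diverge G i v (P i) (R i)"
  obtain p j ks where p: "v = list_encode p" "subtree t p = Some (Branch j ks)"
    using v(1) by (rule inner_node_cases)
  have [simp]: "j = i" using mover_of[OF p(2)] p(1) v(2) by simp
  have "root_path G v (position_path p)" using p root_path_of by simp
  then have box: "P \<in> profiles n (box_at p)" "R \<in> profiles n (box_at p)"
    using consistent_if_passes[OF pass(1) P(1)] consistent_if_passes[OF pass(2) P(2)] by blast+
  obtain k l where kl: "k < length ks" "l < length ks" "k \<noteq> l" "P i \<in> fst (ks ! k)" "R i \<in> fst (ks ! l)"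
    using div out_edges_Branch[OF p(2)] edge_prefs_of[OF p(2)] p(1) by (auto simp: diverge_def)
  have "fst (ks ! k) \<noteq> fst (ks ! l)"
    using branch_at(4)[OF p(2)] kl by (metis length_map nth_eq_iff_index_eq nth_map)
  moreover have "P \<in> profiles n ((box_at p)(i := fst (ks ! k)))"
    "R \<in> profiles n ((box_at p)(i := fst (ks ! l)))"
    using profiles_upd[OF box(1) i kl(4)] profiles_upd[OF box(2) i kl(5)] by simp_all
  ultimately have "(f P i, f R i) \<in> (P i)\<^sup>="
    using branch_at(6)[OF p(2), of "fst (ks ! k)" "fst (ks ! l)" P R] kl by simp
  then show "(result G P i, result G R i) \<in> (P i)\<^sup>=" using mechanism_of_result P by simp
qed

end

end

section \<open>The equivalence\<close>

lemma simple_game_imp_simply_strategy_proof: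
  assumes "simple_game n (allocations n A a0) f Ps {1..n} t"
    and "\<And>i. Ps i \<subseteq> strict_orders (insert a0 A)"
  shows "simply_strategy_proof n A a0 Ps f"
  unfolding simply_strategy_proof_def
proof (intro exI conjI ballI)
  let ?G = "mechanism_of t"
  show "is_mechanism n A a0 Ps ?G" by (rule mechanism_of_mechanism[OF refl assms])
  show "simple ?G" by (rule mechanism_of_simple[OF refl assms])
  show "osp n Ps ?G" by (rule mechanism_of_osp[OF refl assms])
  show "f P = result ?G P" if "P \<in> profiles n Ps" for P
    using that by (rule mechanism_of_result[OF refl assms])
qed

lemma all_acceptable_orders_nonempty:
  assumes "finite A" "a0 \<notin> A"
  shows "all_acceptable_orders A a0 \<noteq> {}"
proof -
  obtain g :: "'a \<Rightarrow> nat" where g: "inj_on g A"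
    using assms(1) finite_imp_inj_to_nat_seg by blast
  \<comment> \<open>Objects are ordered by their numbers under \<open>g\<close>, and
    \<open>a0\<close> comes last.\<close>
  define P where "P = {(x, y). x \<in> A \<and> (y \<in> A \<and> g x < g y \<or> y = a0)}"
  have "trans P" by (rule transI) (use assms(2) in \<open>auto simp: P_def\<close>)
  moreover have "irrefl P" using assms(2) by (auto simp: irrefl_def P_def)
  moreover have "total_on (insert a0 A) P"
  proof (rule total_onI)
    fix x y assume "x \<in> insert a0 A" "y \<in> insert a0 A" "x \<noteq> y"
    moreover from this have "x \<in> A \<Longrightarrow> y \<in> A \<Longrightarrow> g x < g y \<or> g y < g x"
      using g by (metis inj_on_eq_iff nat_neq_iff)
    ultimately show "(x, y) \<in> P \<or> (y, x) \<in> P" by (auto simp: P_def)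
  qed
  moreover have "P \<subseteq> insert a0 A \<times> insert a0 A" "\<forall>a\<in>A. (a, a0) \<in> P" by (auto simp: P_def)
  ultimately have "P \<in> all_acceptable_orders A a0"
    by (simp add: all_acceptable_orders_def strict_orders_def strict_linear_order_on_def)
  then show ?thesis by blast
qed

theorem theorem6p1:
  fixes n :: nat and A :: "'a set" and a0 :: 'a and prio :: "'a \<Rightarrow> nat rel"
    and Ps :: "nat \<Rightarrow> 'a pref set"
  assumes "finite A" and "A \<noteq> {}" and "a0 \<notin> A"
    and "\<forall>a\<in>A. prio a \<in> strict_orders {1..n}"
    and "Ps \<in> {\<lambda>_. all_acceptable_orders A a0, \<lambda>_. strict_orders (insert a0 A)}"
  shows "simply_strategy_proof n A a0 Ps (fpttc n A a0 prio) \<longleftrightarrow>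
         sosp_implementable n A a0 Ps (fpttc n A a0 prio)"
proof
  let ?f = "fpttc n A a0 prio"
  assume "simply_strategy_proof n A a0 Ps ?f"
  then obtain G :: "(nat, 'a) mechanism" where G: "is_mechanism n A a0 Ps G" "simple G" "osp n Ps G"
    "\<forall>P\<in>profiles n Ps. ?f P = result G P"
    unfolding simply_strategy_proof_def by blast
  interpret game n A a0 Ps G by unfold_locales (rule G(1))
  show "sosp_implementable n A a0 Ps ?f"
    unfolding sosp_implementable_def using G simple_osp_imp_sosp by blast
next
  let ?f = "fpttc n A a0 prio" and ?B = "insert a0 A"
  interpret market n A a0 prio using assms by unfold_locales auto
  obtain F where F: "Ps = (\<lambda>_. F)" "F = all_acceptable_orders A a0 \<or> F = strict_orders ?B"
    using assms(5) by blast
  have rich: "rich_domain ?B F"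
    using F(2) rich_domain_strict_orders rich_domain_all_acceptable[OF assms(3)] by blast
  then have sub: "F \<subseteq> strict_orders ?B" by (simp add: rich_domain_def)
  \<comment> \<open>One witness serves both domains, as the orders with all objects acceptable are
    among all strict orders. Nonempty factors ensure that each class is reached by some
    profile.\<close>
  have "F \<noteq> {}"
    using F(2) all_acceptable_orders_nonempty[OF assms(1,3)]
    by (auto simp: all_acceptable_orders_def)
  assume "sosp_implementable n A a0 Ps ?f"
  then obtain G :: "(nat, 'a) mechanism" where G: "is_mechanism n A a0 Ps G" "sosp n Ps G"
    "\<forall>P\<in>profiles n Ps. ?f P = result G P"
    unfolding sosp_implementable_def by blast
  interpret game n A a0 Ps G by unfold_locales (rule G(1))
  have "sosp_game n (allocations n A a0) ?f Ps" using sosp_game_root[OF G(2)] G(3) by blast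
  \<comment> \<open>At the root every agent is still fresh, so the condition on spent agents is
    empty.\<close>
  then have "\<exists>t. simple_game n (allocations n A a0) ?f Ps {1..n} t"
  proof (rule sosp_game_imp_simple_game[OF _ rich])
    show "?f P = ?f (P(i := q))"
      if "\<And>j. j \<in> {1..n} \<Longrightarrow> P j \<in> F" "i \<in> {1..n}" "q \<in> F" "?f P i = ?f (P(i := q)) i" for P i q
      using fpttc_nonbossy[of P q i] that sub by blast
  qed (use F \<open>F \<noteq> {}\<close> in auto)
  then show "simply_strategy_proof n A a0 Ps ?f"
    using simple_game_imp_simply_strategy_proof[of n A a0 ?f Ps] F(1) sub by auto
qed

end
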